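(* Let $\mathcal{S}\subset\mathbb{Z}\times\mathbb{Z}$ be a finite set with nonzero weights $(w_s)_{s\in\mathcal{S}}$ in $\mathbb{C}$, and assume that the Laurent polynomial $S(X,Y)=\sum_{s\in\mathcal{S}}w_sX^{s_x}Y^{s_y}$ is not univariate. Let $\mathcal{O}$ be the orbit of the walk, $k=\mathbb{C}(S(x,y))$, and $k(\mathcal{O})$ the subfield of $\mathbb{K}=\overline{\mathbb{C}(x,y)}$ generated over $k$ by the coordinates of all pairs in $\mathcal{O}$. Let $G_x=\operatorname{Aut}(k(\mathcal{O})|k(x))$, $G_y=\operatorname{Aut}(k(\mathcal{O})|k(y))$, $G_{xy}=G_x\cap G_y$, and let $G=\langle G_x,G_y\rangle$ be the group of the walk. Let $I_x\ni\operatorname{id}$ and $I_y\ni\operatorname{id}$ be sets of representatives of the left cosets $G_x/G_{xy}$ and $G_y/G_{xy}$ respectively. Then the subgroup $\langle I_x,I_y\rangle$ of $G$ acts transitively on $\mathcal{O}$.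
   Context: Here $x,y$ are two indeterminates and $\mathbb{K}=\overline{\mathbb{C}(x,y)}$ is an algebraic closure of $\mathbb{C}(x,y)$. "Not univariate" means that both variables $X$ and $Y$ actually occur in $S(X,Y)$. Two pairs $(u,v),(u',v')\in\mathbb{K}\times\mathbb{K}$ are $x$-adjacent, written $(u,v)\sim^x(u',v')$, if $u=u'$ and $S(u,v)=S(u',v')$; they are $y$-adjacent, written $(u,v)\sim^y(u',v')$, if $v=v'$ and $S(u,v)=S(u',v')$. They are adjacent, written $\sim$, if they are $x$-adjacent or $y$-adjacent, and $\sim^*$ is the transitive closure of $\sim$. The orbit of the walk $\mathcal{O}$ is the set of pairs $(u,v)\in\mathbb{K}\times\mathbb{K}$ with $(u,v)\sim^*(x,y)$ (it may be infinite). $\operatorname{Aut}(M|L)$ denotes the group of $L$-algebra automorphisms of $M$. The group $G$ is the subgroup of $\operatorname{Aut}(k(\mathcal{O})|k)$ generated by $G_x$ and $G_y$; it acts on $\mathcal{O}$ by $\sigma\cdot(u,v)=(\sigma(u),\sigma(v))$. The coset sets $G_x/G_{xy}$ and $G_y/G_{xy}$ are finite, so $I_x$ and $I_y$ are finite sets. *)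

theory Defs
  imports
    "HOL-Algebra.Algebraic_Closure_Type"
    "HOL-Algebra.Generated_Fields"
    "HOL-Algebra.Generated_Groups"
    "HOL-Algebra.Group_Action"
    "HOL-Algebra.Left_Coset"
begin

text \<open>
  In \<open>complex poly poly\<close> the inner variable is \<open>x\<close> and the outer variable is \<open>y\<close>, so the
  fraction field below is \<open>\<complex>(x, y)\<close> and the type is its algebraic closure.
\<close>
type_synonym walk_field = "complex poly poly fract alg_closure"

abbreviation KK :: "walk_field ring" where
  "KK \<equiv> ring_of_type_algebra"

definition const_KK :: "complex \<Rightarrow> walk_field" where
  "const_KK c = to_ac (to_fract [:[:c:]:])"

definition x_KK :: walk_field where
  "x_KK = to_ac (to_fract [:[:0, 1:]:])"

definition y_KK :: walk_field where
  "y_KK = to_ac (to_fract [:0, 1:])"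


section \<open>The step polynomial and the orbit of the walk\<close>

definition not_univariate :: "(int \<times> int) set \<Rightarrow> bool" where
  "not_univariate \<S> \<longleftrightarrow> (\<exists>s\<in>\<S>. fst s \<noteq> 0) \<and> (\<exists>s\<in>\<S>. snd s \<noteq> 0)"

definition step_poly ::
    "(int \<times> int) set \<Rightarrow> (int \<times> int \<Rightarrow> complex) \<Rightarrow> walk_field \<times> walk_field \<Rightarrow> walk_field" where
  "step_poly \<S> w p = (\<Sum>s\<in>\<S>. const_KK (w s) * fst p powi fst s * snd p powi snd s)"

text \<open>
  A Laurent polynomial has no value at a point where a variable with a negative exponent
  vanishes, whereas \<^const>\<open>power_int\<close> is total.  Adjacency therefore asks for the two values
  of \<open>S\<close> to be defined.
\<close>
definition step_poly_defined :: "(int \<times> int) set \<Rightarrow> walk_field \<times> walk_field \<Rightarrow> bool" where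
  "step_poly_defined \<S> p \<longleftrightarrow>
     (\<forall>s\<in>\<S>. (fst s < 0 \<longrightarrow> fst p \<noteq> 0) \<and> (snd s < 0 \<longrightarrow> snd p \<noteq> 0))"

definition step_poly_eq ::
    "(int \<times> int) set \<Rightarrow> (int \<times> int \<Rightarrow> complex) \<Rightarrow>
     walk_field \<times> walk_field \<Rightarrow> walk_field \<times> walk_field \<Rightarrow> bool" where
  "step_poly_eq \<S> w p q \<longleftrightarrow>
     step_poly_defined \<S> p \<and> step_poly_defined \<S> q \<and> step_poly \<S> w p = step_poly \<S> w q"

definition x_adjacent ::
    "(int \<times> int) set \<Rightarrow> (int \<times> int \<Rightarrow> complex) \<Rightarrow>
     walk_field \<times> walk_field \<Rightarrow> walk_field \<times> walk_field \<Rightarrow> bool" where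
  "x_adjacent \<S> w p q \<longleftrightarrow> fst p = fst q \<and> step_poly_eq \<S> w p q"

definition y_adjacent ::
    "(int \<times> int) set \<Rightarrow> (int \<times> int \<Rightarrow> complex) \<Rightarrow>
     walk_field \<times> walk_field \<Rightarrow> walk_field \<times> walk_field \<Rightarrow> bool" where
  "y_adjacent \<S> w p q \<longleftrightarrow> snd p = snd q \<and> step_poly_eq \<S> w p q"

definition adjacent ::
    "(int \<times> int) set \<Rightarrow> (int \<times> int \<Rightarrow> complex) \<Rightarrow>
     walk_field \<times> walk_field \<Rightarrow> walk_field \<times> walk_field \<Rightarrow> bool" where
  "adjacent \<S> w p q \<longleftrightarrow> x_adjacent \<S> w p q \<or> y_adjacent \<S> w p q"

definition walk_orbit ::
    "(int \<times> int) set \<Rightarrow> (int \<times> int \<Rightarrow> complex) \<Rightarrow> (walk_field \<times> walk_field) set" where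
  "walk_orbit \<S> w = {p. (adjacent \<S> w)\<^sup>+\<^sup>+ p (x_KK, y_KK)}"


section \<open>The fields\<close>

definition k_base ::
    "(int \<times> int) set \<Rightarrow> (int \<times> int \<Rightarrow> complex) \<Rightarrow> walk_field set" where
  "k_base \<S> w = generate_field KK (range const_KK \<union> {step_poly \<S> w (x_KK, y_KK)})"

definition k_adjoin ::
    "(int \<times> int) set \<Rightarrow> (int \<times> int \<Rightarrow> complex) \<Rightarrow> walk_field set \<Rightarrow> walk_field set" where
  "k_adjoin \<S> w A = generate_field KK (k_base \<S> w \<union> A)"

definition k_orbit ::
    "(int \<times> int) set \<Rightarrow> (int \<times> int \<Rightarrow> complex) \<Rightarrow> walk_field set" where
  "k_orbit \<S> w = k_adjoin \<S> w (fst ` walk_orbit \<S> w \<union> snd ` walk_orbit \<S> w)"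


section \<open>The group of the walk\<close>

text \<open>
  The automorphisms of \<open>M\<close> over \<open>L\<close>, for subfields \<open>L \<subseteq> M\<close> of \<open>R\<close>, under composition.
  Elements of \<^term>\<open>Bij M\<close> are \<^const>\<open>undefined\<close> outside \<open>M\<close>, so every automorphism
  is represented by exactly one function.
\<close>
definition Aut_over ::
    "('a, 'b) ring_scheme \<Rightarrow> 'a set \<Rightarrow> 'a set \<Rightarrow> ('a \<Rightarrow> 'a) monoid" where
  "Aut_over R M L = (BijGroup M)\<lparr>carrier :=
     {\<sigma> \<in> Bij M. \<sigma> \<in> Ring.ring_hom (R\<lparr>carrier := M\<rparr>) (R\<lparr>carrier := M\<rparr>) \<and> (\<forall>a\<in>L. \<sigma> a = a)}\<rparr>"

definition G_x ::
    "(int \<times> int) set \<Rightarrow> (int \<times> int \<Rightarrow> complex) \<Rightarrow> (walk_field \<Rightarrow> walk_field) monoid" where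
  "G_x \<S> w = Aut_over KK (k_orbit \<S> w) (k_adjoin \<S> w {x_KK})"

definition G_y ::
    "(int \<times> int) set \<Rightarrow> (int \<times> int \<Rightarrow> complex) \<Rightarrow> (walk_field \<Rightarrow> walk_field) monoid" where
  "G_y \<S> w = Aut_over KK (k_orbit \<S> w) (k_adjoin \<S> w {y_KK})"

definition G_xy ::
    "(int \<times> int) set \<Rightarrow> (int \<times> int \<Rightarrow> complex) \<Rightarrow> (walk_field \<Rightarrow> walk_field) set" where
  "G_xy \<S> w = carrier (G_x \<S> w) \<inter> carrier (G_y \<S> w)"

definition walk_group ::
    "(int \<times> int) set \<Rightarrow> (int \<times> int \<Rightarrow> complex) \<Rightarrow> (walk_field \<Rightarrow> walk_field) monoid" where
  "walk_group \<S> w =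
     (let A = Aut_over KK (k_orbit \<S> w) (k_base \<S> w)
      in A\<lparr>carrier := generate A (carrier (G_x \<S> w) \<union> carrier (G_y \<S> w))\<rparr>)"

definition walk_action ::
    "(int \<times> int) set \<Rightarrow> (int \<times> int \<Rightarrow> complex) \<Rightarrow>
     (walk_field \<Rightarrow> walk_field) \<Rightarrow> walk_field \<times> walk_field \<Rightarrow> walk_field \<times> walk_field" where
  "walk_action \<S> w \<sigma> = (\<lambda>p\<in>walk_orbit \<S> w. (\<sigma> (fst p), \<sigma> (snd p)))"

definition left_coset_reps :: "('a, 'b) monoid_scheme \<Rightarrow> 'a set \<Rightarrow> 'a set \<Rightarrow> bool" where
  "left_coset_reps G H I \<longleftrightarrow> I \<subseteq> carrier G \<and> (\<forall>C\<in>lcosets\<^bsub>G\<^esub> H. \<exists>!i. i \<in> I \<and> i \<in> C)"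

end

theory Submission
  imports Defs
begin

text \<open>
  Let \<open>S(x, v) = S(x, y)\<close>.  Then \<open>v\<close> is transcendental over \<open>\<complex>(x)\<close>, so \<open>x \<mapsto> x\<close>, \<open>y \<mapsto> v\<close> defines
  an embedding of \<open>\<complex>(x, y)\<close> into its algebraic closure, which extends to an automorphism of the
  algebraic closure because \<open>y\<close> is algebraic over \<open>\<complex>(x, v)\<close>.  It fixes \<open>S(x, y)\<close> and \<open>x\<close>, hence
  permutes the orbit and restricts to an element \<open>\<sigma>\<close> of \<open>G_x\<close> with \<open>\<sigma>(x, y) = (x, v)\<close>.  The
  representative of the coset \<open>\<sigma> G_xy\<close> does the same, since \<open>G_xy\<close> fixes \<open>x\<close> and \<open>y\<close>.  Any other point of
  the orbit is reached along a path of adjacent pairs: if \<open>p\<close> is adjacent to \<open>g(x, y)\<close>, then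
  \<open>g\<inverse> p\<close> is adjacent to \<open>(x, y)\<close>, so \<open>g\<inverse> p = i(x, y)\<close> for a representative \<open>i\<close>, and \<open>p = g i (x, y)\<close>.
\<close>

text \<open>Two steps of the argument carry the weight. Transcendence of v is not obtained by
  counting degrees. The dilations taking y to i y, for i = 1, 2, ..., extend to embeddings over
  C(x); they separate y infinitely often, whereas an algebraic v would have only finitely many
  images. Both are tied together by S(x, v) = S(x, y), and S(x, Y) takes no value infinitely often
  because Y occurs in S. Extending the embedding yields at first only an endomorphism of the
  closure. Its image is algebraically closed, and it contains y because y is a root of S(x, Y) -
  S(x, y), cleared of denominators, whose coefficients the endomorphism fixes. So the image contains
  C(x, y), hence everything. Working in the whole closure, rather than in k(O), means that a
  possibly infinite orbit is never enumerated: adjacency is preserved by every homomorphism over C,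
  so the automorphism and its inverse map the orbit into itself as soon as they do so for (x,
  y).\<close>

section \<open>Field homomorphisms with an explicit domain\<close>

text \<open>The domain \<open>M\<close> is explicit because automorphisms of k(O) are
  \<open>undefined\<close> outside it, while embeddings of the closure are total (the case
  \<open>UNIV\<close>). With \<open>inverse 0 = 0\<close>, closure under inverses has no exception
  at 0.\<close>

locale subfield_hom =
  fixes M :: "'a::Fields.field set" and \<tau> :: "'a \<Rightarrow> 'b::Fields.field"
  assumes one_mem: "1 \<in> M"
    and add_mem: "a \<in> M \<Longrightarrow> b \<in> M \<Longrightarrow> a + b \<in> M"
    and uminus_mem: "a \<in> M \<Longrightarrow> - a \<in> M"
    and mult_mem: "a \<in> M \<Longrightarrow> b \<in> M \<Longrightarrow> a * b \<in> M"
    and inverse_mem: "a \<in> M \<Longrightarrow> inverse a \<in> M"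
    and hom_one: "\<tau> 1 = 1"
    and hom_add: "a \<in> M \<Longrightarrow> b \<in> M \<Longrightarrow> \<tau> (a + b) = \<tau> a + \<tau> b"
    and hom_mult: "a \<in> M \<Longrightarrow> b \<in> M \<Longrightarrow> \<tau> (a * b) = \<tau> a * \<tau> b"
begin

lemma zero_mem: "0 \<in> M"
  using add_mem[OF one_mem uminus_mem[OF one_mem]] by simp

lemma hom_zero: "\<tau> 0 = 0"
  using hom_add[OF zero_mem zero_mem] by (metis add_0 add_right_cancel)

lemma hom_uminus: "a \<in> M \<Longrightarrow> \<tau> (- a) = - \<tau> a"
  using hom_add[of a "- a"] uminus_mem[of a] hom_zero by (simp add: eq_neg_iff_add_eq_0 add.commute)

lemma hom_diff: "a \<in> M \<Longrightarrow> b \<in> M \<Longrightarrow> \<tau> (a - b) = \<tau> a - \<tau> b"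
  using hom_add[of a "- b"] uminus_mem[of b] hom_uminus[of b] by simp

lemma diff_mem: "a \<in> M \<Longrightarrow> b \<in> M \<Longrightarrow> a - b \<in> M"
  using add_mem[of a "- b"] uminus_mem[of b] by simp

lemma hom_eq_0_iff: "a \<in> M \<Longrightarrow> \<tau> a = 0 \<longleftrightarrow> a = 0"
  using hom_mult[of a "inverse a"] inverse_mem[of a] hom_one hom_zero by (cases "a = 0") auto

lemma hom_eq_iff: "a \<in> M \<Longrightarrow> b \<in> M \<Longrightarrow> \<tau> a = \<tau> b \<longleftrightarrow> a = b"
  using hom_eq_0_iff[of "a - b"] diff_mem[of a b] hom_diff[of a b] by simp

lemma hom_inverse:
  assumes "a \<in> M"
  shows "\<tau> (inverse a) = inverse (\<tau> a)"
proof (cases "a = 0")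
  case False
  then have "\<tau> a * \<tau> (inverse a) = 1"
    using hom_mult[of a "inverse a"] inverse_mem[of a] hom_one assms by simp
  then show ?thesis
    by (simp add: inverse_unique)
qed (simp add: hom_zero)

lemma power_mem: "a \<in> M \<Longrightarrow> a ^ n \<in> M"
  by (induction n) (auto simp: one_mem mult_mem)

lemma hom_power: "a \<in> M \<Longrightarrow> \<tau> (a ^ n) = \<tau> a ^ n"
  by (induction n) (auto simp: hom_one hom_mult power_mem)

lemma powi_mem: "a \<in> M \<Longrightarrow> a powi n \<in> M"
  by (auto simp: power_int_def power_mem inverse_mem)

lemma hom_powi: "a \<in> M \<Longrightarrow> \<tau> (a powi n) = \<tau> a powi n"
  by (auto simp: power_int_def hom_power hom_inverse inverse_mem)

lemma sum_mem: "(\<And>i. i \<in> I \<Longrightarrow> f i \<in> M) \<Longrightarrow> sum f I \<in> M"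
  by (induction I rule: infinite_finite_induct) (auto simp: zero_mem add_mem)

lemma hom_sum: "(\<And>i. i \<in> I \<Longrightarrow> f i \<in> M) \<Longrightarrow> \<tau> (sum f I) = (\<Sum>i\<in>I. \<tau> (f i))"
  by (induction I rule: infinite_finite_induct) (auto simp: hom_zero hom_add sum_mem)

end

abbreviation field_hom :: "('a::Fields.field \<Rightarrow> 'b::Fields.field) \<Rightarrow> bool" where
  "field_hom \<equiv> subfield_hom UNIV"

lemma field_homI:
  assumes "\<tau> 1 = 1" "\<And>a b. \<tau> (a + b) = \<tau> a + \<tau> b" "\<And>a b. \<tau> (a * b) = \<tau> a * \<tau> b"
  shows "field_hom \<tau>"
  by unfold_locales (auto simp: assms)

section \<open>Extension of embeddings into an algebraically closed field\<close>

text \<open>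
  The graph of an isomorphism between two subrings.  The condition \<open>a = 0 \<longleftrightarrow> b = 0\<close> makes it
  single-valued and injective, and is stable under unions of chains.
\<close>
definition ring_graph :: "('a::Fields.field \<times> 'b::Fields.field) set \<Rightarrow> bool" where
  "ring_graph \<Gamma> \<longleftrightarrow> (1, 1) \<in> \<Gamma> \<and>
     (\<forall>a b c d. (a, b) \<in> \<Gamma> \<longrightarrow> (c, d) \<in> \<Gamma> \<longrightarrow> (a - c, b - d) \<in> \<Gamma> \<and> (a * c, b * d) \<in> \<Gamma>) \<and>
     (\<forall>a b. (a, b) \<in> \<Gamma> \<longrightarrow> a = 0 \<longleftrightarrow> b = 0)"

lemma ring_graph_converse: "ring_graph \<Gamma> \<Longrightarrow> ring_graph (\<Gamma>\<inverse>)"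
  unfolding ring_graph_def by auto

context
  fixes \<Gamma> :: "('a::Fields.field \<times> 'b::Fields.field) set"
  assumes \<Gamma>: "ring_graph \<Gamma>"
begin

lemma ring_graph_one: "(1, 1) \<in> \<Gamma>"
  and ring_graph_diff: "(a, b) \<in> \<Gamma> \<Longrightarrow> (c, d) \<in> \<Gamma> \<Longrightarrow> (a - c, b - d) \<in> \<Gamma>"
  and ring_graph_mult: "(a, b) \<in> \<Gamma> \<Longrightarrow> (c, d) \<in> \<Gamma> \<Longrightarrow> (a * c, b * d) \<in> \<Gamma>"
  and ring_graph_0_iff: "(a, b) \<in> \<Gamma> \<Longrightarrow> a = 0 \<longleftrightarrow> b = 0"
  using \<Gamma> unfolding ring_graph_def by blast+

lemma ring_graph_zero: "(0, 0) \<in> \<Gamma>"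
  using ring_graph_diff[OF ring_graph_one ring_graph_one] by simp

lemma ring_graph_add: "(a, b) \<in> \<Gamma> \<Longrightarrow> (c, d) \<in> \<Gamma> \<Longrightarrow> (a + c, b + d) \<in> \<Gamma>"
  using ring_graph_diff[of a b "- c" "- d"] ring_graph_diff[OF ring_graph_zero, of c d] by simp

lemma ring_graph_power: "(a, b) \<in> \<Gamma> \<Longrightarrow> (a ^ n, b ^ n) \<in> \<Gamma>"
  by (induction n) (auto simp: ring_graph_one ring_graph_mult)

lemma ring_graph_sum:
  "(\<And>i. i \<in> I \<Longrightarrow> (f i, g i) \<in> \<Gamma>) \<Longrightarrow> (sum f I, sum g I) \<in> \<Gamma>"
  by (induction I rule: infinite_finite_induct) (auto simp: ring_graph_zero ring_graph_add)

lemma ring_graph_unique: "(a, b) \<in> \<Gamma> \<Longrightarrow> (a, c) \<in> \<Gamma> \<Longrightarrow> b = c"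
  using ring_graph_diff[of a b a c] ring_graph_0_iff[of 0 "b - c"] by simp

text \<open>Localisation at the powers of a and b. Dividing by a nonzero element does not change
  whether something vanishes, so the zero condition survives. In a maximal graph this makes the
  domain a field.\<close>

lemma ring_graph_localize:
  assumes ab: "(a, b) \<in> \<Gamma>" and "a \<noteq> 0"
  obtains \<Gamma>' where "ring_graph \<Gamma>'" "\<Gamma> \<subseteq> \<Gamma>'" "(inverse a, inverse b) \<in> \<Gamma>'"
proof
  define \<Gamma>' where "\<Gamma>' = {(c / a ^ n, d / b ^ n) | c d n. (c, d) \<in> \<Gamma>}"
  have "b \<noteq> 0"
    using ring_graph_0_iff[OF ab] \<open>a \<noteq> 0\<close> by simp
  have I: "(c / a ^ n, d / b ^ n) \<in> \<Gamma>'" if "(c, d) \<in> \<Gamma>" for c d n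
    using that unfolding \<Gamma>'_def by blast
  show sub: "\<Gamma> \<subseteq> \<Gamma>'"
    using I[of _ _ 0] by auto
  show "(inverse a, inverse b) \<in> \<Gamma>'"
    using I[OF ring_graph_one, of 1] by (simp add: divide_inverse)
  show "ring_graph \<Gamma>'"
    unfolding ring_graph_def
  proof (intro conjI allI impI)
    show "(1, 1) \<in> \<Gamma>'"
      using sub ring_graph_one by blast
  next
    fix p q r s assume "(p, q) \<in> \<Gamma>'" "(r, s) \<in> \<Gamma>'"
    then obtain c d n c' d' m where
      cd: "(c, d) \<in> \<Gamma>" "p = c / a ^ n" "q = d / b ^ n" "(c', d') \<in> \<Gamma>" "r = c' / a ^ m" "s = d' / b ^ m"
      unfolding \<Gamma>'_def by blast
    have "(c * a ^ m - c' * a ^ n, d * b ^ m - d' * b ^ n) \<in> \<Gamma>"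
      by (intro ring_graph_diff ring_graph_mult ring_graph_power cd ab)
    from I[OF this, of "n + m"] show "(p - r, q - s) \<in> \<Gamma>'"
      using \<open>a \<noteq> 0\<close> \<open>b \<noteq> 0\<close> by (simp add: cd diff_frac_eq power_add)
    from I[OF ring_graph_mult[OF cd(1,4)], of "n + m"] show "(p * r, q * s) \<in> \<Gamma>'"
      by (simp add: cd power_add)
  next
    fix p q assume "(p, q) \<in> \<Gamma>'"
    then show "p = 0 \<longleftrightarrow> q = 0"
      unfolding \<Gamma>'_def using \<open>a \<noteq> 0\<close> \<open>b \<noteq> 0\<close> ring_graph_0_iff by auto
  qed
qed

end

section \<open>Polynomials with corresponding coefficients\<close>

text \<open>A relation instead of a coefficient map: no partial function has to be chosen, and the
  two sides can be exchanged by \<open>poly_graph_converse\<close>.\<close>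

definition poly_graph ::
    "('a::Fields.field \<times> 'b::Fields.field) set \<Rightarrow> ('a poly \<times> 'b poly) set" where
  "poly_graph \<Gamma> = {(p, q). \<forall>i. (Polynomial.coeff p i, Polynomial.coeff q i) \<in> \<Gamma>}"

lemma poly_graph_converse: "(q, p) \<in> poly_graph (\<Gamma>\<inverse>) \<longleftrightarrow> (p, q) \<in> poly_graph \<Gamma>"
  unfolding poly_graph_def by auto

context
  fixes \<Gamma> :: "('a::Fields.field \<times> 'b::Fields.field) set"
  assumes \<Gamma>: "ring_graph \<Gamma>"
begin

lemma poly_graph_diff:
  "(p, p') \<in> poly_graph \<Gamma> \<Longrightarrow> (q, q') \<in> poly_graph \<Gamma> \<Longrightarrow> (p - q, p' - q') \<in> poly_graph \<Gamma>"
  unfolding poly_graph_def by (auto intro: ring_graph_diff[OF \<Gamma>])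

lemma poly_graph_add:
  "(p, p') \<in> poly_graph \<Gamma> \<Longrightarrow> (q, q') \<in> poly_graph \<Gamma> \<Longrightarrow> (p + q, p' + q') \<in> poly_graph \<Gamma>"
  unfolding poly_graph_def by (auto intro: ring_graph_add[OF \<Gamma>])

lemma poly_graph_mult:
  "(p, p') \<in> poly_graph \<Gamma> \<Longrightarrow> (q, q') \<in> poly_graph \<Gamma> \<Longrightarrow> (p * q, p' * q') \<in> poly_graph \<Gamma>"
  unfolding poly_graph_def
  by (auto simp: coeff_mult intro!: ring_graph_sum[OF \<Gamma>] ring_graph_mult[OF \<Gamma>])

lemma poly_graph_monom: "(a, b) \<in> \<Gamma> \<Longrightarrow> (Polynomial.monom a n, Polynomial.monom b n) \<in> poly_graph \<Gamma>"
  unfolding poly_graph_def by (auto simp: ring_graph_zero[OF \<Gamma>])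

lemma poly_graph_0_iff: "(p, q) \<in> poly_graph \<Gamma> \<Longrightarrow> p = 0 \<longleftrightarrow> q = 0"
  using ring_graph_0_iff[OF \<Gamma>] unfolding poly_graph_def by (auto simp: poly_eq_iff)

lemma poly_graph_degree:
  assumes "(p, q) \<in> poly_graph \<Gamma>"
  shows "Polynomial.degree p = Polynomial.degree q"
proof -
  have "Polynomial.coeff p i = 0 \<longleftrightarrow> Polynomial.coeff q i = 0" for i
    using assms ring_graph_0_iff[OF \<Gamma>] unfolding poly_graph_def by blast
  then show ?thesis
    unfolding Polynomial.degree_def by simp
qed

text \<open>Long division performed on both sides with the same steps: the quotient is built from
  coefficients and the inverse leading coefficient, all of which have companions in
  \<Gamma>.\<close>

lemma poly_graph_division:
  assumes inv: "\<forall>(a, b)\<in>\<Gamma>. (inverse a, inverse b) \<in> \<Gamma>"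
    and p: "(p, p') \<in> poly_graph \<Gamma>" and "p \<noteq> 0"
    and "(q, q') \<in> poly_graph \<Gamma>"
  obtains s s' r r' where "(s, s') \<in> poly_graph \<Gamma>" "(r, r') \<in> poly_graph \<Gamma>"
    "q = p * s + r" "q' = p' * s' + r'" "r = 0 \<or> Polynomial.degree r < Polynomial.degree p"
proof -
  let ?d = "Polynomial.degree p"
  define c where "c = inverse (Polynomial.coeff p ?d)"
  define c' where "c' = inverse (Polynomial.coeff p' ?d)"
  have c: "(c, c') \<in> \<Gamma>"
    using p inv unfolding c_def c'_def poly_graph_def by blast
  have cp: "c * Polynomial.coeff p ?d = 1"
    using \<open>p \<noteq> 0\<close> by (simp add: c_def)
  \<comment> \<open>Induction on a strict degree bound \<open>n\<close> for \<open>q\<close>; each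
    step cancels the coefficient of index \<open>n\<close>, until \<open>q\<close> itself qualifies
    as remainder.\<close>
  have "\<exists>s s' r r'. (s, s') \<in> poly_graph \<Gamma> \<and> (r, r') \<in> poly_graph \<Gamma> \<and>
      q = p * s + r \<and> q' = p' * s' + r' \<and> (\<forall>i\<ge>?d. Polynomial.coeff r i = 0)"
    if "\<forall>i\<ge>n. Polynomial.coeff q i = 0" for n
    using that \<open>(q, q') \<in> poly_graph \<Gamma>\<close>
  proof (induction n arbitrary: q q')
    case 0
    have "(0, 0) \<in> poly_graph \<Gamma>"
      by (simp add: poly_graph_def ring_graph_zero[OF \<Gamma>])
    moreover from 0 have "q = 0"
      by (simp add: poly_eq_iff)
    moreover from this have "q' = 0"
      using poly_graph_0_iff 0 by blast
    ultimately show ?case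
      by (intro exI[of _ 0]) simp
  next
    case (Suc n)
    show ?case
    proof (cases "n < ?d")
      case True
      have "(0, 0) \<in> poly_graph \<Gamma>"
        by (simp add: poly_graph_def ring_graph_zero[OF \<Gamma>])
      with True Suc.prems show ?thesis
        by (intro exI[of _ 0] exI[of _ q] exI[of _ q']) auto
    next
      case False
      define m where "m = Polynomial.monom (Polynomial.coeff q n * c) (n - ?d)"
      define m' where "m' = Polynomial.monom (Polynomial.coeff q' n * c') (n - ?d)"
      have m: "(m, m') \<in> poly_graph \<Gamma>"
        unfolding m_def m'_def using Suc.prems(2)
        by (intro poly_graph_monom ring_graph_mult[OF \<Gamma>] c) (simp add: poly_graph_def)
      have "Polynomial.coeff (q - p * m) i = 0" if "n \<le> i" for i
      proof (cases "i = n")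
        case True
        then show ?thesis
          using False cp by (simp add: m_def mult.commute[of p] coeff_monom_mult mult.assoc)
      next
        case False
        with that have "?d < i - (n - ?d)" "\<not> i < n - ?d" "Suc n \<le> i"
          using \<open>\<not> n < ?d\<close> by auto
        then show ?thesis
          using Suc.prems(1)
          by (simp add: m_def mult.commute[of p] coeff_monom_mult coeff_eq_0)
      qed
      moreover have "(q - p * m, q' - p' * m') \<in> poly_graph \<Gamma>"
        by (intro poly_graph_diff poly_graph_mult m p Suc.prems)
      ultimately obtain s s' r r' where *: "(s, s') \<in> poly_graph \<Gamma>" "(r, r') \<in> poly_graph \<Gamma>"
        "q - p * m = p * s + r" "q' - p' * m' = p' * s' + r'" "\<forall>i\<ge>?d. Polynomial.coeff r i = 0"
        using Suc.IH by blast
      then have "q = p * (m + s) + r" "q' = p' * (m' + s') + r'"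
        by (simp_all add: algebra_simps)
      with * show ?thesis
        using poly_graph_add[OF m *(1)] by blast
    qed
  qed
  from this[of "Suc (Polynomial.degree q)"] obtain s s' r r'
    where *: "(s, s') \<in> poly_graph \<Gamma>" "(r, r') \<in> poly_graph \<Gamma>"
      "q = p * s + r" "q' = p' * s' + r'" "\<forall>i\<ge>?d. Polynomial.coeff r i = 0"
    using coeff_eq_0[of q] by auto
  have "r = 0 \<or> Polynomial.degree r < ?d"
    using *(5) leading_coeff_0_iff[of r] by (meson not_less)
  with * that show ?thesis
    by blast
qed

text \<open>The remainder modulo \<open>p\<close> of a polynomial vanishing at \<alpha> vanishes
  there as well, so minimality makes it zero. By \<open>poly_graph_0_iff\<close> its companion is
  zero too, which carries the divisibility over to the other side.\<close>

lemma poly_graph_minimal: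
  assumes inv: "\<forall>(a, b)\<in>\<Gamma>. (inverse a, inverse b) \<in> \<Gamma>"
    and "(p\<^sub>0, p\<^sub>0') \<in> poly_graph \<Gamma>" "p\<^sub>0 \<noteq> 0" "poly p\<^sub>0 \<alpha> = 0"
  obtains p p' where "(p, p') \<in> poly_graph \<Gamma>" "p \<noteq> 0" "poly p \<alpha> = 0"
    "\<forall>(q, q')\<in>poly_graph \<Gamma>. poly q \<alpha> = 0 \<longrightarrow>
       (\<exists>s s'. (s, s') \<in> poly_graph \<Gamma> \<and> q = p * s \<and> q' = p' * s')"
proof -
  define R where "R = (\<lambda>(p, p'). (p, p') \<in> poly_graph \<Gamma> \<and> p \<noteq> 0 \<and> poly p \<alpha> = 0)"
  have "R (p\<^sub>0, p\<^sub>0')"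
    using assms by (simp add: R_def)
  from ex_has_least_nat[of R, OF this, of "\<lambda>(p, p'). Polynomial.degree p"]
  obtain p p' where R: "R (p, p')"
    and min: "\<And>q q'. R (q, q') \<Longrightarrow> Polynomial.degree p \<le> Polynomial.degree q"
    by auto
  then have p: "(p, p') \<in> poly_graph \<Gamma>" "p \<noteq> 0" "poly p \<alpha> = 0"
    by (auto simp: R_def)
  show ?thesis
  proof (rule that[OF p], clarify)
    fix q q' assume q: "(q, q') \<in> poly_graph \<Gamma>" "poly q \<alpha> = 0"
    obtain s s' r r' where *: "(s, s') \<in> poly_graph \<Gamma>" "(r, r') \<in> poly_graph \<Gamma>"
      "q = p * s + r" "q' = p' * s' + r'" "r = 0 \<or> Polynomial.degree r < Polynomial.degree p"
      by (rule poly_graph_division[OF inv p(1,2) q(1)])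
    have "poly r \<alpha> = 0"
      using *(3) q(2) p(3) by simp
    then have "r = 0"
      using *(2,5) min[of r r'] unfolding R_def by fastforce
    moreover from this have "r' = 0"
      using poly_graph_0_iff[OF *(2)] by simp
    ultimately show "\<exists>s s'. (s, s') \<in> poly_graph \<Gamma> \<and> q = p * s \<and> q' = p' * s'"
      using * by auto
  qed
qed

end

text \<open>
  \<open>\<beta>\<close> is a root of the image \<open>p'\<close> of a polynomial \<open>p\<close> of minimal degree with root \<open>\<alpha>\<close>.  Taking a
  polynomial \<open>r'\<close> of minimal degree with root \<open>\<beta>\<close> as well shows that \<open>\<alpha>\<close> and \<open>\<beta>\<close> satisfy
  corresponding equations, with no need for irreducibility.
\<close>
lemma ring_graph_adjoin_root:
  fixes \<Gamma> :: "('a::Fields.field \<times> 'b::alg_closed_field) set"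
  assumes \<Gamma>: "ring_graph \<Gamma>" and inv: "\<forall>(a, b)\<in>\<Gamma>. (inverse a, inverse b) \<in> \<Gamma>"
    and p\<^sub>0: "(p\<^sub>0, p\<^sub>0') \<in> poly_graph \<Gamma>" "p\<^sub>0 \<noteq> 0" "poly p\<^sub>0 \<alpha> = 0"
  obtains \<Gamma>' \<beta> where "ring_graph \<Gamma>'" "\<Gamma> \<subseteq> \<Gamma>'" "(\<alpha>, \<beta>) \<in> \<Gamma>'"
proof -
  obtain p p' where p: "(p, p') \<in> poly_graph \<Gamma>" "p \<noteq> 0" "poly p \<alpha> = 0"
    and pdvd: "\<forall>(q, q')\<in>poly_graph \<Gamma>. poly q \<alpha> = 0 \<longrightarrow>
       (\<exists>s s'. (s, s') \<in> poly_graph \<Gamma> \<and> q = p * s \<and> q' = p' * s')"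
    by (rule poly_graph_minimal[OF \<Gamma> inv p\<^sub>0])
  have const: False if "q \<noteq> 0" "Polynomial.degree q = 0" "poly q a = 0"
    for q :: "'c::Fields.field poly" and a
    using that by (auto elim!: degree_eq_zeroE)
  have "Polynomial.degree p' > 0"
    using const[OF p(2) _ p(3)] poly_graph_degree[OF \<Gamma> p(1)] by auto
  then obtain \<beta> where \<beta>: "poly p' \<beta> = 0"
    using alg_closed_imp_poly_has_root by blast
  have inv': "\<forall>(b, a)\<in>\<Gamma>\<inverse>. (inverse b, inverse a) \<in> \<Gamma>\<inverse>"
    using inv by auto
  have "p' \<noteq> 0" "(p', p) \<in> poly_graph (\<Gamma>\<inverse>)"
    using p poly_graph_0_iff[OF \<Gamma> p(1)] by (auto simp: poly_graph_converse)
  then obtain r' r where "(r', r) \<in> poly_graph (\<Gamma>\<inverse>)" "r' \<noteq> 0" "poly r' \<beta> = 0"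
    and rdvd': "\<forall>(q', q)\<in>poly_graph (\<Gamma>\<inverse>). poly q' \<beta> = 0 \<longrightarrow>
       (\<exists>s' s. (s', s) \<in> poly_graph (\<Gamma>\<inverse>) \<and> q' = r' * s' \<and> q = r * s)"
    using poly_graph_minimal[OF ring_graph_converse[OF \<Gamma>] inv' _ _ \<beta>] by blast
  then have r: "(r, r') \<in> poly_graph \<Gamma>" "r' \<noteq> 0" "poly r' \<beta> = 0"
    by (simp_all add: poly_graph_converse)
  have rdvd: "\<exists>s s'. (s, s') \<in> poly_graph \<Gamma> \<and> q = r * s \<and> q' = r' * s'"
    if "(q, q') \<in> poly_graph \<Gamma>" "poly q' \<beta> = 0" for q q'
  proof -
    from that(1) have "(q', q) \<in> poly_graph (\<Gamma>\<inverse>)"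
      by (simp add: poly_graph_converse)
    from bspec[OF rdvd' this] that(2) show ?thesis
      by (auto simp: poly_graph_converse)
  qed
  obtain s s' where s: "(s, s') \<in> poly_graph \<Gamma>" "p = r * s"
    using rdvd[OF p(1) \<beta>] by blast
  \<comment> \<open>Otherwise the cofactor \<open>s\<close> in \<open>p = r * s\<close> has the root
    \<alpha> and is a multiple of \<open>p\<close>, which makes \<open>r\<close> a unit. Then
    \<open>r'\<close> is constant as well, although it is nonzero and has the root \<beta>.\<close>
  have "poly r \<alpha> = 0"
  proof (rule ccontr)
    assume "poly r \<alpha> \<noteq> 0"
    with s p have "poly s \<alpha> = 0" by simp
    then obtain t where "s = p * t"
      using bspec[OF pdvd s(1)] by auto
    with s(2) p(2) have "r * t = 1"
      by simp
    then have "is_unit r"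
      by (metis dvd_triv_left)
    then have "Polynomial.degree r = 0"
      by (simp add: is_unit_iff_degree poly_graph_0_iff[OF \<Gamma> r(1)] r(2))
    with const[OF r(2) _ r(3)] show False
      using poly_graph_degree[OF \<Gamma> r(1)] by simp
  qed
  \<comment> \<open>From left to right, \<open>q'\<close> is a multiple of \<open>p'\<close>; from
    right to left, \<open>q\<close> is a multiple of \<open>r\<close>. This is the zero condition
    for the enlarged graph.\<close>
  then have iff: "poly q \<alpha> = 0 \<longleftrightarrow> poly q' \<beta> = 0" if "(q, q') \<in> poly_graph \<Gamma>" for q q'
    using bspec[OF pdvd that] rdvd[OF that] \<beta> \<open>poly r \<alpha> = 0\<close> p(3) by auto
  define \<Gamma>' where "\<Gamma>' = {(poly q \<alpha>, poly q' \<beta>) | q q'. (q, q') \<in> poly_graph \<Gamma>}"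
  have I: "(poly q \<alpha>, poly q' \<beta>) \<in> \<Gamma>'" if "(q, q') \<in> poly_graph \<Gamma>" for q q'
    using that unfolding \<Gamma>'_def by blast
  have sub: "\<Gamma> \<subseteq> \<Gamma>'"
    using I[OF poly_graph_monom[OF \<Gamma>, of _ _ 0]] by (auto simp: poly_monom)
  moreover have "(\<alpha>, \<beta>) \<in> \<Gamma>'"
    using I[OF poly_graph_monom[OF \<Gamma> ring_graph_one[OF \<Gamma>], of 1]] by (simp add: poly_monom)
  moreover have "ring_graph \<Gamma>'"
    unfolding ring_graph_def
  proof (intro conjI allI impI)
    show "(1, 1) \<in> \<Gamma>'"
      using sub ring_graph_one[OF \<Gamma>] by blast
  next
    fix a b c d assume "(a, b) \<in> \<Gamma>'" "(c, d) \<in> \<Gamma>'"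
    then obtain q q' t t' where *: "(q, q') \<in> poly_graph \<Gamma>" "(t, t') \<in> poly_graph \<Gamma>"
      "a = poly q \<alpha>" "b = poly q' \<beta>" "c = poly t \<alpha>" "d = poly t' \<beta>"
      unfolding \<Gamma>'_def by blast
    show "(a - c, b - d) \<in> \<Gamma>'" "(a * c, b * d) \<in> \<Gamma>'"
      using I[OF poly_graph_diff[OF \<Gamma> *(1,2)]] I[OF poly_graph_mult[OF \<Gamma> *(1,2)]] * by simp_all
  next
    fix a b assume "(a, b) \<in> \<Gamma>'"
    then show "a = 0 \<longleftrightarrow> b = 0"
      unfolding \<Gamma>'_def using iff by auto
  qed
  ultimately show ?thesis
    using that by blast
qed

text \<open>Zorn's lemma gives a maximal graph above \<Gamma>. Localisation shows that it is closed
  under inverses, so it covers the quotients of elements of \<open>Domain \<Gamma>\<close>;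
  adjoining roots then forces every \<alpha> into its domain.\<close>

theorem ring_graph_extends_to_hom:
  fixes \<Gamma> :: "('a::Fields.field \<times> 'b::alg_closed_field) set"
  assumes \<Gamma>: "ring_graph \<Gamma>"
    and alg: "\<And>\<alpha>. \<exists>p. p \<noteq> 0 \<and> poly p \<alpha> = 0 \<and>
           (\<forall>i. \<exists>a\<in>Domain \<Gamma>. \<exists>b\<in>Domain \<Gamma>. Polynomial.coeff p i = a / b)"
  obtains \<tau> where "field_hom \<tau>" "\<And>a b. (a, b) \<in> \<Gamma> \<Longrightarrow> \<tau> a = b"
proof -
  define A where "A = {\<Delta>. \<Gamma> \<subseteq> \<Delta> \<and> ring_graph \<Delta>}"
  have "\<exists>M\<in>A. \<forall>\<Delta>\<in>A. M \<subseteq> \<Delta> \<longrightarrow> \<Delta> = M"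
  proof (rule subset_Zorn_nonempty)
    show "A \<noteq> {}"
      using \<Gamma> by (auto simp: A_def)
    fix C assume "C \<noteq> {}" and chain: "subset.chain A C"
    then have sub: "C \<subseteq> A"
      by (simp add: subset_chain_def)
    have "ring_graph (\<Union>C)"
      unfolding ring_graph_def
    proof (intro conjI allI impI)
      show "(1, 1) \<in> \<Union>C"
        using \<open>C \<noteq> {}\<close> sub ring_graph_one unfolding A_def by blast
    next
      fix a b c d assume "(a, b) \<in> \<Union>C" "(c, d) \<in> \<Union>C"
      then obtain \<Delta> where "\<Delta> \<in> C" "(a, b) \<in> \<Delta>" "(c, d) \<in> \<Delta>"
        using chain unfolding subset_chain_def by blast
      then show "(a - c, b - d) \<in> \<Union>C" "(a * c, b * d) \<in> \<Union>C"
        using sub ring_graph_diff ring_graph_mult unfolding A_def by blast+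
    next
      fix a b assume "(a, b) \<in> \<Union>C"
      then show "a = 0 \<longleftrightarrow> b = 0"
        using sub ring_graph_0_iff unfolding A_def by blast
    qed
    then show "\<Union>C \<in> A"
      using \<open>C \<noteq> {}\<close> sub unfolding A_def by blast
  qed
  then obtain M where "M \<in> A" and maxA: "\<And>\<Delta>. \<Delta> \<in> A \<Longrightarrow> M \<subseteq> \<Delta> \<Longrightarrow> \<Delta> = M"
    by blast
  then have M: "\<Gamma> \<subseteq> M" "ring_graph M"
    by (simp_all add: A_def)
  have max: "\<Delta> = M" if "ring_graph \<Delta>" "M \<subseteq> \<Delta>" for \<Delta>
    using that M(1) by (intro maxA) (auto simp: A_def)
  have inv: "(inverse a, inverse b) \<in> M" if ab: "(a, b) \<in> M" for a b
  proof (cases "a = 0")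
    case True
    with ab show ?thesis
      using ring_graph_0_iff[OF M(2) ab] by simp
  next
    case False
    then obtain \<Delta> where "ring_graph \<Delta>" "M \<subseteq> \<Delta>" "(inverse a, inverse b) \<in> \<Delta>"
      using ring_graph_localize[OF M(2) ab] by blast
    with max show ?thesis
      by blast
  qed
  have total: "\<alpha> \<in> Domain M" for \<alpha>
  proof -
    obtain p where p: "p \<noteq> 0" "poly p \<alpha> = 0"
      "\<And>i. \<exists>a\<in>Domain \<Gamma>. \<exists>b\<in>Domain \<Gamma>. Polynomial.coeff p i = a / b"
      using alg by blast
    have dom: "\<exists>b. (Polynomial.coeff p i, b) \<in> M" for i
    proof -
      obtain a b c d where "(a, c) \<in> M" "(b, d) \<in> M" "Polynomial.coeff p i = a / b"
        using p(3)[of i] M(1) by blast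
      then have "(a / b, c / d) \<in> M"
        unfolding divide_inverse by (intro ring_graph_mult[OF M(2)] inv)
      then show ?thesis
        using \<open>Polynomial.coeff p i = a / b\<close> by auto
    qed
    \<comment> \<open>\<open>map_poly\<close> expects a function, so companions are selected from
      the single-valued relation \<open>M\<close>. The value \<open>f 0 = 0\<close> makes the
      coefficients beyond the degree correspond.\<close>
    define f where "f a = (THE b. (a, b) \<in> M)" for a
    have f: "(a, f a) \<in> M" if "(a, b) \<in> M" for a b
      using that ring_graph_unique[OF M(2)] unfolding f_def by (metis the_equality)
    have "f 0 = 0"
      using f[OF ring_graph_zero[OF M(2)]] ring_graph_0_iff[OF M(2)] by blast
    then have "(p, map_poly f p) \<in> poly_graph M"
      using dom f by (auto simp: poly_graph_def coeff_map_poly)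
    then obtain \<Delta> \<beta> where "ring_graph \<Delta>" "M \<subseteq> \<Delta>" "(\<alpha>, \<beta>) \<in> \<Delta>"
      using ring_graph_adjoin_root[OF M(2) _ _ p(1,2)] inv by blast
    with max show ?thesis
      by blast
  qed
  define \<tau> where "\<tau> a = (THE b. (a, b) \<in> M)" for a
  have \<tau>: "\<tau> a = b" if "(a, b) \<in> M" for a b
    using that ring_graph_unique[OF M(2)] unfolding \<tau>_def by blast
  have mem: "(a, \<tau> a) \<in> M" for a
    using total[of a] \<tau> by blast
  have "field_hom \<tau>"
    by (intro field_homI \<tau> ring_graph_one[OF M(2)] ring_graph_add[OF M(2)] ring_graph_mult[OF M(2)] mem)
  with \<tau> M(1) that show ?thesis
    by blast
qed

section \<open>Algebraic independence\<close>

locale comm_ring_hom =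
  fixes h :: "'a::comm_ring_1 \<Rightarrow> 'b::comm_ring_1"
  assumes hom_one: "h 1 = 1"
    and hom_add: "h (a + b) = h a + h b"
    and hom_mult: "h (a * b) = h a * h b"
begin

lemma hom_zero: "h 0 = 0"
  using hom_add[of 0 0] by (metis add_0 add_right_cancel)

lemma hom_diff: "h (a - b) = h a - h b"
  using hom_add[of "a - b" b] by (simp add: eq_diff_eq)

lemma eval_pCons: "poly (map_poly h (pCons a p)) b = h a + b * poly (map_poly h p) b"
  by (simp add: map_poly_pCons hom_zero)

lemma eval_const: "poly (map_poly h [:a:]) b = h a"
  by (simp add: eval_pCons)

lemma eval_X: "poly (map_poly h [:0, 1:]) b = b"
  by (simp add: eval_pCons hom_zero hom_one)

lemma eval_add: "poly (map_poly h (p + q)) b = poly (map_poly h p) b + poly (map_poly h q) b"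
  by (induction p q rule: poly_induct2) (simp_all add: eval_pCons hom_add algebra_simps)

lemma eval_smult: "poly (map_poly h (Polynomial.smult c p)) b = h c * poly (map_poly h p) b"
  by (induction p) (simp_all add: eval_pCons hom_mult algebra_simps)

lemma eval_mult: "poly (map_poly h (p * q)) b = poly (map_poly h p) b * poly (map_poly h q) b"
  by (induction p) (simp_all add: eval_pCons eval_add eval_smult hom_zero algebra_simps)

text \<open>Allows iteration: evaluation in the inner variable is again a homomorphism, along which
  the outer variable can be evaluated.\<close>

lemma comm_ring_hom_eval: "comm_ring_hom (\<lambda>p. poly (map_poly h p) b)"
  by unfold_locales (simp_all add: eval_add eval_mult hom_one)

lemma eval_pcompose:
  "poly (map_poly h (pcompose p q)) b = poly (map_poly h p) (poly (map_poly h q) b)"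
  by (induction p) (simp_all add: pcompose_pCons eval_pCons eval_add eval_mult eval_const)

text \<open>The free bound \<open>n\<close> makes bivariate evaluation a sum over a square, whose
  order of summation can be exchanged.\<close>

lemma eval_eq_sum:
  assumes "Polynomial.degree p \<le> n"
  shows "poly (map_poly h p) b = (\<Sum>i\<le>n. h (Polynomial.coeff p i) * b ^ i)"
proof -
  have "Polynomial.degree (map_poly h p) \<le> n"
    using assms by (intro degree_le) (auto simp: coeff_map_poly coeff_eq_0 hom_zero)
  then have "poly (map_poly h p) b = (\<Sum>i\<le>n. Polynomial.coeff (map_poly h p) i * b ^ i)"
    unfolding poly_altdef by (intro sum.mono_neutral_left) (auto simp: coeff_eq_0)
  then show ?thesis
    by (simp add: coeff_map_poly hom_zero)
qed

end

lemma const_KK_add: "const_KK (a + b) = const_KK a + const_KK b"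
  unfolding const_KK_def by (simp flip: to_ac_add to_fract_add)

lemma const_KK_mult: "const_KK (a * b) = const_KK a * const_KK b"
  unfolding const_KK_def by (simp flip: to_ac_mult to_fract_mult)

lemma const_KK_1: "const_KK 1 = 1"
  unfolding const_KK_def by (simp flip: one_pCons)

interpretation const_KK: comm_ring_hom const_KK
  by unfold_locales (simp_all add: const_KK_1 const_KK_add const_KK_mult)

lemma const_KK_eq_0_iff: "const_KK c = 0 \<longleftrightarrow> c = 0"
  unfolding const_KK_def by simp

lemma const_KK_eq_iff: "const_KK c = const_KK d \<longleftrightarrow> c = d"
  using const_KK_eq_0_iff[of "c - d"] by (simp add: const_KK.hom_diff)

section \<open>Evaluation of bivariate polynomials and independent pairs\<close>

definition eval_x :: "walk_field \<Rightarrow> complex poly \<Rightarrow> walk_field" where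
  "eval_x a p = poly (map_poly const_KK p) a"

definition eval_xy :: "walk_field \<Rightarrow> walk_field \<Rightarrow> complex poly poly \<Rightarrow> walk_field" where
  "eval_xy a b P = poly (map_poly (eval_x a) P) b"

interpretation eval_x: comm_ring_hom "eval_x a" for a
  unfolding eval_x_def by (rule const_KK.comm_ring_hom_eval)

interpretation eval_xy: comm_ring_hom "eval_xy a b" for a b
  unfolding eval_xy_def by (rule eval_x.comm_ring_hom_eval)

lemma eval_xy_const: "eval_xy a b [:[:c:]:] = const_KK c"
  by (simp add: eval_xy_def eval_x.eval_const) (simp add: eval_x_def const_KK.eval_const)

lemma eval_xy_x: "eval_xy a b [:[:0, 1:]:] = a"
  by (simp add: eval_xy_def eval_x.eval_const) (simp add: eval_x_def const_KK.eval_X)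

lemma eval_xy_y: "eval_xy a b [:0, 1:] = b"
  unfolding eval_xy_def by (rule eval_x.eval_X)

lemma to_ac_to_fract_pconst: "to_ac (to_fract [:p:]) = eval_x x_KK p"
proof (induction p)
  case (pCons c p)
  have "[:pCons c p:] = [:[:c:]:] + [:[:0, 1:]:] * [:p:]"
    by simp
  then have "to_ac (to_fract [:pCons c p:]) = const_KK c + x_KK * to_ac (to_fract [:p:])"
    unfolding const_KK_def x_KK_def by (simp only: to_fract_add to_fract_mult to_ac_add to_ac_mult)
  with pCons.IH show ?case
    by (simp add: eval_x_def const_KK.eval_pCons)
qed (simp add: eval_x.hom_zero)

lemma to_ac_to_fract: "to_ac (to_fract P) = eval_xy x_KK y_KK P"
proof (induction P)
  case (pCons p P)
  have "pCons p P = [:p:] + [:0, 1:] * P"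
    by simp
  then have "to_ac (to_fract (pCons p P)) = to_ac (to_fract [:p:]) + y_KK * to_ac (to_fract P)"
    unfolding y_KK_def by (simp only: to_fract_add to_fract_mult to_ac_add to_ac_mult)
  with pCons.IH show ?case
    by (simp add: eval_xy_def eval_x.eval_pCons to_ac_to_fract_pconst)
qed (simp add: eval_xy.hom_zero)

definition alg_indep :: "walk_field \<Rightarrow> walk_field \<Rightarrow> bool" where
  "alg_indep a b \<longleftrightarrow> (\<forall>P. eval_xy a b P = 0 \<longrightarrow> P = 0)"

lemma alg_indep_x_y: "alg_indep x_KK y_KK"
  unfolding alg_indep_def by (simp flip: to_ac_to_fract)

lemma eval_xy_eq_sum:
  assumes "Polynomial.degree P \<le> n" "\<And>j. Polynomial.degree (Polynomial.coeff P j) \<le> n"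
  shows "eval_xy a b P =
    (\<Sum>j\<le>n. \<Sum>i\<le>n. const_KK (Polynomial.coeff (Polynomial.coeff P j) i) * a ^ i * b ^ j)"
  unfolding eval_xy_def eval_x.eval_eq_sum[OF assms(1)]
  by (simp add: eval_x_def const_KK.eval_eq_sum[OF assms(2)] sum_distrib_right)

text \<open>The nested polynomial type orders its variables, so a relation for (b, a) is turned into
  one for (a, b) by transposing the coefficient matrix.\<close>

lemma alg_indep_sym:
  assumes "alg_indep a b"
  shows "alg_indep b a"
  unfolding alg_indep_def
proof (intro allI impI)
  fix P assume P: "eval_xy b a P = 0"
  \<comment> \<open>A common bound for the degrees in both variables, so that \<open>P\<close> and
    its transpose \<open>Q\<close> are summed over the same square.\<close>
  define n where "n = Polynomial.degree P + (\<Sum>j\<le>Polynomial.degree P. Polynomial.degree (Polynomial.coeff P j))"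
  have n: "Polynomial.degree P \<le> n"
    by (simp add: n_def)
  have nc: "Polynomial.degree (Polynomial.coeff P j) \<le> n" for j
  proof (cases "j \<le> Polynomial.degree P")
    case True
    then have "Polynomial.degree (Polynomial.coeff P j)
        \<le> (\<Sum>j\<le>Polynomial.degree P. Polynomial.degree (Polynomial.coeff P j))"
      by (intro member_le_sum) auto
    then show ?thesis
      by (simp add: n_def)
  qed (simp add: coeff_eq_0)
  define Q where "Q = (\<Sum>i\<le>n. Polynomial.monom
    (\<Sum>j\<le>n. Polynomial.monom (Polynomial.coeff (Polynomial.coeff P j) i) j) i)"
  have Q: "Polynomial.coeff Q i = (if i \<le> n then
    (\<Sum>j\<le>n. Polynomial.monom (Polynomial.coeff (Polynomial.coeff P j) i) j) else 0)" for i
    by (simp add: Q_def coeff_sum if_distrib[of "\<lambda>x. x = _"] sum.delta)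
  have Qc: "Polynomial.coeff (Polynomial.coeff Q i) j =
      (if i \<le> n \<and> j \<le> n then Polynomial.coeff (Polynomial.coeff P j) i else 0)" for i j
    by (simp add: Q coeff_sum sum.delta)
  have "Polynomial.degree Q \<le> n" "Polynomial.degree (Polynomial.coeff Q i) \<le> n" for i
    by (auto intro!: degree_le simp: Q Qc coeff_sum)
  from eval_xy_eq_sum[OF this, of a b]
  have "eval_xy a b Q = (\<Sum>i\<le>n. \<Sum>j\<le>n. const_KK (Polynomial.coeff (Polynomial.coeff P i) j) * b ^ j * a ^ i)"
    by (subst sum.swap) (simp add: Qc ac_simps)
  also have "\<dots> = 0"
    using P eval_xy_eq_sum[OF n nc, of b a] by simp
  finally have "Q = 0"
    using assms by (simp add: alg_indep_def)
  then have "Polynomial.coeff (Polynomial.coeff P j) i = 0" for i j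
    using Qc[of i j] n nc[of j] coeff_eq_0[of P j] coeff_eq_0[of "Polynomial.coeff P j" i]
    by (cases "i \<le> n \<and> j \<le> n") (auto simp: not_le)
  then show "P = 0"
    by (simp add: poly_eq_iff)
qed

lemma alg_indep_eval_x:
  assumes "alg_indep a b" and "eval_x a p = 0"
  shows "p = 0"
proof -
  have "eval_xy a b [:p:] = 0"
    using assms(2) by (simp add: eval_xy_def eval_x.eval_const)
  then show ?thesis
    using assms(1) by (auto simp: alg_indep_def)
qed

lemma alg_indep_nonzero: "alg_indep a b \<Longrightarrow> a \<noteq> 0"
  using alg_indep_eval_x[of a b "[:0, 1:]"] by (auto simp: eval_x_def const_KK.eval_X)

text \<open>Substituting cY for Y turns a relation for (a, c b) into one for (a, b), and composition
  with a nonconstant polynomial annihilates only 0.\<close>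

lemma alg_indep_scale:
  assumes "alg_indep a b" and "c \<noteq> 0"
  shows "alg_indep a (const_KK c * b)"
  unfolding alg_indep_def
proof (intro allI impI)
  fix P assume P: "eval_xy a (const_KK c * b) P = 0"
  have "poly (map_poly (eval_x a) [:0, [:c:]:]) b = const_KK c * b"
    by (simp add: eval_x.eval_pCons eval_x.hom_zero) (simp add: eval_x_def const_KK.eval_const)
  then have "eval_xy a b (pcompose P [:0, [:c:]:]) = 0"
    using P by (simp add: eval_xy_def eval_x.eval_pcompose)
  then have "pcompose P [:0, [:c:]:] = 0"
    using assms(1) by (simp add: alg_indep_def)
  then show "P = 0"
    by (rule pcompose_eq_0) (use \<open>c \<noteq> 0\<close> in simp)
qed

text \<open>The assignment P(x, y) to P(u, v) is well defined by independence of x, y and injective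
  by independence of u, v. Its domain is C[x, y], over whose fraction field the closure is
  algebraic, so it extends.\<close>

lemma alg_indep_extend:
  assumes "alg_indep u v"
  obtains \<tau> :: "walk_field \<Rightarrow> walk_field"
    where "field_hom \<tau>" "\<And>c. \<tau> (const_KK c) = const_KK c" "\<tau> x_KK = u" "\<tau> y_KK = v"
proof -
  define \<Gamma> where "\<Gamma> = range (\<lambda>P. (eval_xy x_KK y_KK P, eval_xy u v P))"
  have I: "(eval_xy x_KK y_KK P, eval_xy u v P) \<in> \<Gamma>" for P
    by (simp add: \<Gamma>_def)
  have "ring_graph \<Gamma>"
    unfolding ring_graph_def
  proof (intro conjI allI impI)
    show "(1, 1) \<in> \<Gamma>"
      using I[of 1] by (simp add: eval_xy.hom_one)
  next
    fix a b c d assume "(a, b) \<in> \<Gamma>" "(c, d) \<in> \<Gamma>"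
    then obtain P Q where *: "a = eval_xy x_KK y_KK P" "b = eval_xy u v P"
      "c = eval_xy x_KK y_KK Q" "d = eval_xy u v Q"
      by (auto simp: \<Gamma>_def)
    show "(a - c, b - d) \<in> \<Gamma>" "(a * c, b * d) \<in> \<Gamma>"
      using I[of "P - Q"] I[of "P * Q"] by (simp_all add: * eval_xy.hom_diff eval_xy.hom_mult)
  next
    fix a b assume "(a, b) \<in> \<Gamma>"
    then obtain P where "a = eval_xy x_KK y_KK P" "b = eval_xy u v P"
      by (auto simp: \<Gamma>_def)
    then show "a = 0 \<longleftrightarrow> b = 0"
      using assms alg_indep_x_y by (auto simp: alg_indep_def eval_xy.hom_zero)
  qed
  moreover have "\<exists>p. p \<noteq> 0 \<and> poly p \<alpha> = 0 \<and>
      (\<forall>i. \<exists>a\<in>Domain \<Gamma>. \<exists>b\<in>Domain \<Gamma>. Polynomial.coeff p i = a / b)" for \<alpha>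
  proof -
    obtain p where p: "p \<noteq> 0" "poly (map_poly to_ac p) \<alpha> = 0"
      using alg_closure_algebraic[of \<alpha>] by blast
    have "\<exists>a\<in>Domain \<Gamma>. \<exists>b\<in>Domain \<Gamma>. Polynomial.coeff (map_poly to_ac p) i = a / b" for i
    proof -
      obtain P Q where "Polynomial.coeff p i = to_fract P / to_fract Q"
        by (metis Fract_cases Fract_conv_to_fract)
      then have "Polynomial.coeff (map_poly to_ac p) i = eval_xy x_KK y_KK P / eval_xy x_KK y_KK Q"
        by (simp add: coeff_map_poly to_ac_to_fract)
      then show ?thesis
        using I by blast
    qed
    moreover have "map_poly to_ac p \<noteq> 0"
      using p(1) by (simp add: poly_eq_iff coeff_map_poly)
    ultimately show ?thesis
      using p(2) by blast
  qed
  ultimately obtain \<tau> where \<tau>: "field_hom \<tau>" "\<And>a b. (a, b) \<in> \<Gamma> \<Longrightarrow> \<tau> a = b"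
    using ring_graph_extends_to_hom[of \<Gamma>] by blast
  show ?thesis
    using \<tau>(2)[OF I[of "[:[:_:]:]"]] \<tau>(2)[OF I[of "[:[:0, 1:]:]"]] \<tau>(2)[OF I[of "[:0, 1:]"]]
    by (intro that[OF \<tau>(1)]) (simp_all only: eval_xy_const eval_xy_x eval_xy_y)
qed

section \<open>Automorphisms of the algebraic closure moving one coordinate\<close>

context subfield_hom
begin

lemma map_poly_mult_linear:
  assumes "M = UNIV"
  shows "map_poly \<tau> ([:- r, 1:] * q) = [:- \<tau> r, 1:] * map_poly \<tau> q"
proof (rule poly_eqI)
  fix n
  show "Polynomial.coeff (map_poly \<tau> ([:- r, 1:] * q)) n = Polynomial.coeff ([:- \<tau> r, 1:] * map_poly \<tau> q) n"
    using assms
    by (cases n) (simp_all add: coeff_map_poly hom_zero hom_diff hom_mult hom_uminus)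
qed

end

text \<open>Over its algebraically closed source \<open>p\<close> splits into linear factors, so the
  roots of its image are the images of its roots. The induction peels off one factor at a
  time.\<close>

lemma field_hom_root_in_range:
  fixes p :: "'a::alg_closed_field poly" and \<tau> :: "'a \<Rightarrow> 'b::Fields.field"
  assumes \<tau>: "field_hom \<tau>" and "p \<noteq> 0" and "poly (map_poly \<tau> p) b = 0"
  shows "b \<in> range \<tau>"
proof -
  interpret subfield_hom UNIV \<tau>
    by (rule \<tau>)
  show ?thesis
    using assms(2,3)
  proof (induction "Polynomial.degree p" arbitrary: p)
    case 0
    then obtain c where "p = [:c:]"
      by (metis degree_eq_zeroE)
    with 0 show ?case
      by (simp add: map_poly_pCons hom_zero hom_eq_0_iff)
  next
    case (Suc n)
    then obtain r where "poly p r = 0"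
      using alg_closed_imp_poly_has_root[of p] by auto
    then obtain q where q: "p = [:- r, 1:] * q"
      by (auto simp: poly_eq_0_iff_dvd elim!: dvdE)
    then have "q \<noteq> 0"
      using Suc.prems by auto
    then have "n = Polynomial.degree q"
      using Suc.hyps(2) q degree_mult_eq[of "[:- r, 1:]" q] by simp
    moreover have "(b - \<tau> r) * poly (map_poly \<tau> q) b = 0"
      using Suc.prems(2) unfolding q map_poly_mult_linear[OF refl] by (simp add: algebra_simps)
    ultimately show ?case
      using Suc.hyps(1)[OF _ \<open>q \<noteq> 0\<close>] by auto
  qed
qed

text \<open>The range contains C(x, y), so the equation of any algebraic \<alpha> is the image of a
  polynomial \<open>g\<close>, and \<open>field_hom_root_in_range\<close> puts \<alpha> into the
  range.\<close>

lemma surj_field_hom: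
  fixes \<tau> :: "walk_field \<Rightarrow> walk_field"
  assumes \<tau>: "field_hom \<tau>" and const: "\<And>c. \<tau> (const_KK c) = const_KK c"
    and xy: "x_KK \<in> range \<tau>" "y_KK \<in> range \<tau>"
  shows "surj \<tau>"
proof -
  interpret subfield_hom UNIV \<tau>
    by (rule \<tau>)
  have add: "a + b \<in> range \<tau>" and mult: "a * b \<in> range \<tau>" and div: "a / b \<in> range \<tau>"
    if "a \<in> range \<tau>" "b \<in> range \<tau>" for a b
  proof -
    from that obtain a' b' where "a = \<tau> a'" "b = \<tau> b'"
      by blast
    then have "a + b = \<tau> (a' + b')" "a * b = \<tau> (a' * b')" "a / b = \<tau> (a' / b')"
      by (simp_all add: hom_add hom_mult hom_inverse divide_inverse)
    then show "a + b \<in> range \<tau>" "a * b \<in> range \<tau>" "a / b \<in> range \<tau>"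
      by blast+
  qed
  have x: "eval_x x_KK p \<in> range \<tau>" for p
  proof (induction p)
    case (pCons c p)
    have "const_KK c \<in> range \<tau>"
      by (metis const rangeI)
    with pCons.IH show ?case
      unfolding eval_x_def const_KK.eval_pCons by (intro add mult xy)
  qed (metis eval_x.hom_zero hom_zero rangeI)
  have xy: "eval_xy x_KK y_KK P \<in> range \<tau>" for P
  proof (induction P)
    case (pCons p P)
    then show ?case
      unfolding eval_xy_def eval_x.eval_pCons by (intro add mult xy x)
  qed (metis eval_xy.hom_zero hom_zero rangeI)
  have to_ac: "to_ac f \<in> range \<tau>" for f :: "complex poly poly fract"
  proof -
    obtain P Q where "f = to_fract P / to_fract Q"
      by (metis Fract_cases Fract_conv_to_fract)
    then show ?thesis
      by (simp add: to_ac_to_fract div xy)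
  qed
  have "\<alpha> \<in> range \<tau>" for \<alpha>
  proof -
    obtain p where p: "p \<noteq> 0" "poly (map_poly to_ac p) \<alpha> = 0"
      using alg_closure_algebraic[of \<alpha>] by blast
    define g where "g = map_poly (inv_into UNIV \<tau>) (map_poly to_ac p)"
    have inv: "inv_into UNIV \<tau> (\<tau> a) = a" for a
      by (intro inv_f_f injI) (simp add: hom_eq_iff)
    have inv0: "inv_into UNIV \<tau> 0 = 0"
      using inv[of 0] by (simp add: hom_zero)
    have g: "map_poly \<tau> g = map_poly to_ac p"
      using to_ac f_inv_into_f[of _ \<tau> UNIV]
      by (auto simp: g_def poly_eq_iff coeff_map_poly inv0 hom_zero)
    have "g \<noteq> 0"
    proof
      assume "g = 0"
      with g have "map_poly to_ac p = 0"
        by simp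
      with p(1) show False
        by (simp add: poly_eq_iff coeff_map_poly)
    qed
    then show ?thesis
      using field_hom_root_in_range[OF \<tau>, of g \<alpha>] g p(2) by simp
  qed
  then show ?thesis
    by blast
qed

section \<open>The fibres of S(a, Y)\<close>

text \<open>The polynomial \<open>Y\<^sup>n (S(a, Y) - c)\<close>, with \<open>n\<close> large enough to clear negative exponents.\<close>
definition cleared_poly ::
    "(int \<times> int) set \<Rightarrow> (int \<times> int \<Rightarrow> complex) \<Rightarrow> nat \<Rightarrow> walk_field \<Rightarrow> walk_field \<Rightarrow> walk_field poly" where
  "cleared_poly \<S> w n a c =
     (\<Sum>s\<in>\<S>. Polynomial.monom (const_KK (w s) * a powi fst s) (nat (snd s + int n))) - Polynomial.monom c n"

context
  fixes \<S> :: "(int \<times> int) set" and w :: "int \<times> int \<Rightarrow> complex" and n :: nat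
  assumes fin: "finite \<S>" and n: "\<forall>s\<in>\<S>. - snd s \<le> int n"
begin

lemma poly_cleared_poly:
  assumes "b \<noteq> 0"
  shows "poly (cleared_poly \<S> w n a c) b = b ^ n * (step_poly \<S> w (a, b) - c)"
proof -
  have "b ^ nat (snd s + int n) = b ^ n * b powi snd s" if "s \<in> \<S>" for s
  proof -
    have "b ^ nat (snd s + int n) = b powi (snd s + int n)"
      using bspec[OF n that] by (simp add: power_int_def)
    then show ?thesis
      using assms by (simp add: power_int_add)
  qed
  then show ?thesis
    by (simp add: cleared_poly_def step_poly_def poly_sum poly_monom right_diff_distrib
        sum_distrib_left mult_ac)
qed

lemma map_poly_cleared_poly:
  assumes \<tau>: "field_hom \<tau>" and "\<And>c. \<tau> (const_KK c) = const_KK c"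
  shows "map_poly \<tau> (cleared_poly \<S> w n a c) = cleared_poly \<S> w n (\<tau> a) (\<tau> c)"
proof -
  interpret subfield_hom UNIV \<tau>
    by (rule \<tau>)
  show ?thesis
    using assms(2)
    by (auto simp: poly_eq_iff coeff_map_poly hom_zero cleared_poly_def coeff_sum hom_diff hom_sum
        hom_mult hom_powi if_distrib[of \<tau>] intro!: sum.cong)
qed

text \<open>Since \<open>snd t\<close> is nonzero, the monomial of \<open>t\<close> avoids the index
  \<open>n\<close> where \<open>c\<close> is subtracted. Its coefficient is a nonzero Laurent
  polynomial in a, which cannot vanish because a is transcendental.\<close>

lemma cleared_poly_nonzero:
  assumes ab: "alg_indep a b" and w: "\<forall>s\<in>\<S>. w s \<noteq> 0" and t: "t \<in> \<S>" "snd t \<noteq> 0"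
  shows "cleared_poly \<S> w n a c \<noteq> 0"
proof
  assume "cleared_poly \<S> w n a c = 0"
  \<comment> \<open>The steps that contribute to the same power of Y as \<open>t\<close>.\<close>
  define T where "T = {s \<in> \<S>. snd s = snd t}"
  have T: "finite T" "t \<in> T"
    using fin t by (auto simp: T_def)
  have "a \<noteq> 0"
    by (rule alg_indep_nonzero[OF ab])
  have "0 = Polynomial.coeff (cleared_poly \<S> w n a c) (nat (snd t + int n))"
    by (simp add: \<open>cleared_poly \<S> w n a c = 0\<close>)
  also have "\<dots> = (\<Sum>s\<in>\<S>. if snd s = snd t then const_KK (w s) * a powi fst s else 0)"
  proof -
    have "nat (snd s + int n) = nat (snd t + int n) \<longleftrightarrow> snd s = snd t" if "s \<in> \<S>" for s
      using bspec[OF n that] bspec[OF n t(1)] by (simp add: nat_eq_iff)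
    moreover have "n \<noteq> nat (snd t + int n)"
      using bspec[OF n t(1)] t(2) by auto
    ultimately show ?thesis
      by (simp add: cleared_poly_def coeff_sum cong: sum.cong)
  qed
  also have "\<dots> = (\<Sum>s\<in>T. const_KK (w s) * a powi fst s)"
    using fin unfolding T_def by (rule sum.inter_filter[symmetric])
  finally have 0: "(\<Sum>s\<in>T. const_KK (w s) * a powi fst s) = 0"
    by simp
  \<comment> \<open>Large enough to clear the negative exponents of a on \<open>T\<close>, which
    turns the vanishing coefficient into the vanishing value of a polynomial
    \<open>p\<close>.\<close>
  define m where "m = (\<Sum>s\<in>T. nat (- fst s))"
  have m: "- fst s \<le> int m" if "s \<in> T" for s
  proof -
    have "nat (- fst s) \<le> m"
      unfolding m_def using T(1) that by (intro member_le_sum) auto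
    then show ?thesis
      by simp
  qed
  define p where "p = (\<Sum>s\<in>T. Polynomial.monom (w s) (nat (fst s + int m)))"
  have ev: "eval_x a (Polynomial.monom d k) = const_KK d * a ^ k" for d k
    by (simp add: eval_x_def map_poly_monom const_KK.hom_zero poly_monom)
  have "eval_x a p = (\<Sum>s\<in>T. const_KK (w s) * a ^ nat (fst s + int m))"
    unfolding p_def ev[symmetric]
    by (induction T rule: infinite_finite_induct) (simp_all add: eval_x.hom_zero eval_x.hom_add)
  also have "\<dots> = (\<Sum>s\<in>T. a ^ m * (const_KK (w s) * a powi fst s))"
  proof (intro sum.cong refl)
    fix s assume "s \<in> T"
    then have "a ^ nat (fst s + int m) = a powi (fst s + int m)"
      using m by (simp add: power_int_def)
    then show "const_KK (w s) * a ^ nat (fst s + int m) = a ^ m * (const_KK (w s) * a powi fst s)"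
      using \<open>a \<noteq> 0\<close> by (simp add: power_int_add)
  qed
  also have "\<dots> = 0"
    by (simp add: 0 flip: sum_distrib_left)
  finally have "p = 0"
    using alg_indep_eval_x[OF ab] by blast
  moreover have "Polynomial.coeff p (nat (fst t + int m)) = w t"
  proof -
    \<comment> \<open>Steps in \<open>T\<close> agree in the second coordinate, so distinct ones
      differ in the first and their monomials cannot cancel.\<close>
    have "nat (fst s + int m) = nat (fst t + int m) \<longleftrightarrow> s = t" if "s \<in> T" for s
      using m[OF that] m[OF T(2)] that by (auto simp: nat_eq_iff T_def prod_eq_iff)
    then have "Polynomial.coeff p (nat (fst t + int m)) = (\<Sum>s\<in>T. if s = t then w s else 0)"
      by (simp add: p_def coeff_sum cong: sum.cong)
    then show ?thesis
      using T by simp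
  qed
  ultimately show False
    using bspec[OF w t(1)] by simp
qed

end

text \<open>Homomorphisms respect the convention \<open>inverse 0 = 0\<close>, so the identity
  includes points where a negative power of zero occurs.\<close>

lemma hom_step_poly:
  fixes \<tau> :: "walk_field \<Rightarrow> walk_field"
  assumes \<tau>: "subfield_hom M \<tau>"
    and "\<And>c. const_KK c \<in> M" "\<And>c. \<tau> (const_KK c) = const_KK c" "p \<in> M" "q \<in> M"
  shows "\<tau> (step_poly \<S> w (p, q)) = step_poly \<S> w (\<tau> p, \<tau> q)"
proof -
  interpret subfield_hom M \<tau>
    by (rule \<tau>)
  show ?thesis
    using assms(2-) by (simp add: step_poly_def hom_sum hom_mult hom_powi powi_mem mult_mem)
qed

lemma clearing_exponent:
  fixes \<S> :: "(int \<times> int) set"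
  assumes "finite \<S>"
  obtains n where "\<forall>s\<in>\<S>. - snd s \<le> int n"
proof (intro that ballI)
  fix s assume "s \<in> \<S>"
  then have "nat (- snd s) \<le> (\<Sum>s\<in>\<S>. nat (- snd s))"
    using assms by (intro member_le_sum) auto
  then show "- snd s \<le> int (\<Sum>s\<in>\<S>. nat (- snd s))"
    by (simp only: nat_le_iff)
qed

context
  fixes \<S> :: "(int \<times> int) set" and w :: "int \<times> int \<Rightarrow> complex" and a b v :: walk_field
  assumes fin: "finite \<S>" and w: "\<forall>s\<in>\<S>. w s \<noteq> 0" and t: "\<exists>t\<in>\<S>. snd t \<noteq> 0"
    and ab: "alg_indep a b" and v: "step_poly \<S> w (a, v) = step_poly \<S> w (a, b)"
begin

text \<open>Nonzero solutions are roots of a nonzero \<open>cleared_poly\<close>. The level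
  \<open>c\<close> is arbitrary in the closure because it will be S(a, \<theta> v) for an embedding
  \<theta>.\<close>

lemma finite_step_poly_level: "finite {q. q \<noteq> 0 \<and> step_poly \<S> w (a, q) = c}"
proof -
  obtain n where n: "\<forall>s\<in>\<S>. - snd s \<le> int n"
    using clearing_exponent[OF fin] by blast
  have "cleared_poly \<S> w n a c \<noteq> 0"
    using cleared_poly_nonzero[OF fin n ab w] t by blast
  then have "finite {q. poly (cleared_poly \<S> w n a c) q = 0}"
    by (rule poly_roots_finite)
  then show ?thesis
    by (rule rev_finite_subset) (auto simp: poly_cleared_poly[OF fin n])
qed

text \<open>
  If \<open>v\<close> were algebraic over \<open>\<complex>(a)\<close>, two of the embeddings \<open>b \<mapsto> i b\<close> over \<open>\<complex>(a)\<close>, and in fact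
  infinitely many, would agree on \<open>v\<close>, and \<open>S(a, _)\<close> would be constant on infinitely many \<open>i b\<close>.
\<close>
lemma alg_indep_step_poly:
  assumes \<theta>: "\<And>i::nat. i > 0 \<Longrightarrow> \<exists>\<theta>. field_hom \<theta> \<and> (\<forall>c. \<theta> (const_KK c) = const_KK c) \<and>
      \<theta> a = a \<and> \<theta> b = const_KK (of_nat i) * b"
  shows "alg_indep a v"
  unfolding alg_indep_def
proof (intro allI impI, rule ccontr)
  fix P assume P: "eval_xy a v P = 0" "P \<noteq> 0"
  obtain \<theta> :: "nat \<Rightarrow> walk_field \<Rightarrow> walk_field"
    where \<theta>: "\<And>i. i > 0 \<Longrightarrow> field_hom (\<theta> i)" "\<And>i c. i > 0 \<Longrightarrow> \<theta> i (const_KK c) = const_KK c"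
      "\<And>i. i > 0 \<Longrightarrow> \<theta> i a = a" "\<And>i. i > 0 \<Longrightarrow> \<theta> i b = const_KK (of_nat i) * b"
    using \<theta> by metis
  have hom_eval: "\<tau> (poly p q) = poly (map_poly \<tau> p) (\<tau> q)" if "field_hom \<tau>"
    for \<tau> :: "walk_field \<Rightarrow> walk_field" and p q
  proof -
    interpret subfield_hom UNIV \<tau>
      by (rule that)
    show ?thesis
      by (induction p) (simp_all add: map_poly_pCons hom_zero hom_add hom_mult)
  qed
  \<comment> \<open>This is P(a, Y), nonzero because a is transcendental. Every
    \<open>\<theta> i\<close> fixes its coefficients and so permutes v among its finitely many
    roots.\<close>
  let ?Q = "map_poly (eval_x a) P"
  have "?Q \<noteq> 0"
    using P(2) alg_indep_eval_x[OF ab] by (auto simp: poly_eq_iff coeff_map_poly eval_x.hom_zero)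
  then have "finite {q. poly ?Q q = 0}"
    by (rule poly_roots_finite)
  moreover have "\<theta> i v \<in> {q. poly ?Q q = 0}" if "i \<in> {0<..}" for i
  proof -
    interpret subfield_hom UNIV "\<theta> i"
      using \<theta>(1) that by simp
    have "map_poly (\<theta> i) (map_poly const_KK p) = map_poly const_KK p" for p
      using \<theta>(2) that by (simp add: poly_eq_iff coeff_map_poly const_KK.hom_zero hom_zero)
    then have "\<theta> i (eval_x a p) = eval_x a p" for p
      using that by (simp add: eval_x_def hom_eval[OF \<theta>(1)] \<theta>(3))
    then have "map_poly (\<theta> i) ?Q = ?Q"
      by (simp add: poly_eq_iff coeff_map_poly eval_x.hom_zero hom_zero)
    then have "poly ?Q (\<theta> i v) = \<theta> i (poly ?Q v)"
      using hom_eval[OF \<theta>(1), of i ?Q v] that by simp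
    then show ?thesis
      using P(1) by (simp add: eval_xy_def hom_zero)
  qed
  then have "(\<lambda>i. \<theta> i v) ` {0<..} \<subseteq> {q. poly ?Q q = 0}"
    by blast
  ultimately have "finite ((\<lambda>i. \<theta> i v) ` {0<..})"
    by (rule rev_finite_subset)
  then obtain i\<^sub>0 where "infinite {i \<in> {0<..}. \<theta> i v = \<theta> i\<^sub>0 v}" (is "infinite ?I")
    using pigeonhole_infinite[of "{0<..}" "\<lambda>i. \<theta> i v"] infinite_Ioi by blast
  \<comment> \<open>Characteristic zero and b \<noteq> 0 make the multiples of b distinct.\<close>
  moreover have "inj_on (\<lambda>i. const_KK (of_nat i) * b) ?I"
    using alg_indep_nonzero[OF alg_indep_sym[OF ab]] by (auto intro!: inj_onI simp: const_KK_eq_iff)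
  ultimately have "infinite ((\<lambda>i. const_KK (of_nat i) * b) ` ?I)"
    by (simp add: finite_image_iff)
  moreover have "(\<lambda>i. const_KK (of_nat i) * b) ` ?I \<subseteq>
      {q. q \<noteq> 0 \<and> step_poly \<S> w (a, q) = step_poly \<S> w (a, \<theta> i\<^sub>0 v)}"
  proof (rule image_subsetI)
    fix i assume "i \<in> ?I"
    then have i: "i > 0" "\<theta> i v = \<theta> i\<^sub>0 v"
      by auto
    \<comment> \<open>The chain is S(a, i b) = \<theta>(S(a, b)) = \<theta>(S(a, v)) = S(a, \<theta>
      v) with \<theta> = \<open>\<theta> i\<close>, and the last argument is the same for all chosen
      i.\<close>
    have "step_poly \<S> w (a, const_KK (of_nat i) * b) = \<theta> i (step_poly \<S> w (a, b))"
      using i(1) by (simp add: hom_step_poly[OF \<theta>(1) UNIV_I \<theta>(2)] \<theta>(3,4))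
    also have "\<dots> = step_poly \<S> w (a, \<theta> i\<^sub>0 v)"
      using i by (simp add: hom_step_poly[OF \<theta>(1) UNIV_I \<theta>(2)] \<theta>(3) flip: v)
    finally show "const_KK (of_nat i) * b \<in>
        {q. q \<noteq> 0 \<and> step_poly \<S> w (a, q) = step_poly \<S> w (a, \<theta> i\<^sub>0 v)}"
      using i(1) alg_indep_nonzero[OF alg_indep_sym[OF ab]] by (simp add: const_KK_eq_0_iff)
  qed
  ultimately show False
    using finite_step_poly_level finite_subset by blast
qed

text \<open>At level S(a, b) the cleared polynomial is its own image, because \<tau> sends S(a, b)
  to S(a, v), the same element. Hence its root b lies in the range.\<close>

lemma step_poly_hom_range:
  assumes "field_hom \<tau>" "\<And>c. \<tau> (const_KK c) = const_KK c" "\<tau> a = a" "\<tau> b = v"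
  shows "b \<in> range \<tau>"
proof -
  obtain n where n: "\<forall>s\<in>\<S>. - snd s \<le> int n"
    using clearing_exponent[OF fin] by blast
  let ?c = "step_poly \<S> w (a, b)"
  have "\<tau> ?c = ?c"
    using hom_step_poly[OF assms(1) UNIV_I assms(2), of a b] assms(3,4) v by simp
  then have "map_poly \<tau> (cleared_poly \<S> w n a ?c) = cleared_poly \<S> w n a ?c"
    by (simp add: map_poly_cleared_poly[OF fin n assms(1,2)] assms(3))
  moreover have "poly (cleared_poly \<S> w n a ?c) b = 0"
    by (simp add: poly_cleared_poly[OF fin n alg_indep_nonzero[OF alg_indep_sym[OF ab]]])
  moreover have "cleared_poly \<S> w n a ?c \<noteq> 0"
    using cleared_poly_nonzero[OF fin n ab w] t by blast
  ultimately show ?thesis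
    using field_hom_root_in_range[OF assms(1)] by metis
qed

end

lemma step_poly_swap:
  "step_poly (prod.swap ` \<S>) (w \<circ> prod.swap) (q, p) = step_poly \<S> w (p, q)"
  unfolding step_poly_def by (subst sum.reindex) (auto intro!: sum.cong)

lemma ex_automorphism_x:
  assumes "finite \<S>" "\<forall>s\<in>\<S>. w s \<noteq> 0" "\<exists>s\<in>\<S>. snd s \<noteq> 0"
    and "step_poly \<S> w (x_KK, v) = step_poly \<S> w (x_KK, y_KK)"
  obtains \<tau> where "field_hom \<tau>" "surj \<tau>" "\<And>c. \<tau> (const_KK c) = const_KK c" "\<tau> x_KK = x_KK" "\<tau> y_KK = v"
proof -
  note hyps = assms(1-3) alg_indep_x_y assms(4)
  have "\<exists>\<theta>. field_hom \<theta> \<and> (\<forall>c. \<theta> (const_KK c) = const_KK c) \<and>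
      \<theta> x_KK = x_KK \<and> \<theta> y_KK = const_KK (of_nat i) * y_KK" if "i > 0" for i :: nat
    using alg_indep_extend[OF alg_indep_scale[OF alg_indep_x_y, of "of_nat i"]] that
    by (metis of_nat_0_eq_iff less_irrefl)
  then have "alg_indep x_KK v"
    by (rule alg_indep_step_poly[OF hyps])
  then obtain \<tau> where \<tau>: "field_hom \<tau>" "\<And>c. \<tau> (const_KK c) = const_KK c" "\<tau> x_KK = x_KK" "\<tau> y_KK = v"
    using alg_indep_extend by blast
  then have "y_KK \<in> range \<tau>"
    by (rule step_poly_hom_range[OF hyps])
  then have "surj \<tau>"
    using surj_field_hom[OF \<tau>(1,2)] \<tau>(3) by (metis rangeI)
  with \<tau> that show ?thesis
    by blast
qed

text \<open>The general pair a, b of the preceding lemmas is instantiated with y, x and the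
  reflected step set; \<open>alg_indep_sym\<close> restores the variable order that
  \<open>alg_indep_extend\<close> expects.\<close>

lemma ex_automorphism_y:
  assumes "finite \<S>" "\<forall>s\<in>\<S>. w s \<noteq> 0" "\<exists>s\<in>\<S>. fst s \<noteq> 0"
    and "step_poly \<S> w (u, y_KK) = step_poly \<S> w (x_KK, y_KK)"
  obtains \<tau> where "field_hom \<tau>" "surj \<tau>" "\<And>c. \<tau> (const_KK c) = const_KK c" "\<tau> x_KK = u" "\<tau> y_KK = y_KK"
proof -
  define \<S>' where "\<S>' = prod.swap ` \<S>"
  define w' where "w' = w \<circ> prod.swap"
  have hyps: "finite \<S>'" "\<forall>s\<in>\<S>'. w' s \<noteq> 0" "\<exists>s\<in>\<S>'. snd s \<noteq> 0" "alg_indep y_KK x_KK"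
    "step_poly \<S>' w' (y_KK, u) = step_poly \<S>' w' (y_KK, x_KK)"
    using assms by (auto simp: \<S>'_def w'_def step_poly_swap intro: alg_indep_sym alg_indep_x_y)
  have "\<exists>\<theta>. field_hom \<theta> \<and> (\<forall>c. \<theta> (const_KK c) = const_KK c) \<and>
      \<theta> y_KK = y_KK \<and> \<theta> x_KK = const_KK (of_nat i) * x_KK" if "i > 0" for i :: nat
    using alg_indep_extend[OF alg_indep_sym[OF alg_indep_scale[OF hyps(4), of "of_nat i"]]] that
    by (metis of_nat_0_eq_iff less_irrefl)
  then have "alg_indep y_KK u"
    by (rule alg_indep_step_poly[OF hyps])
  from alg_indep_extend[OF alg_indep_sym[OF this]]
  obtain \<tau> where \<tau>: "field_hom \<tau>" "\<And>c. \<tau> (const_KK c) = const_KK c" "\<tau> x_KK = u" "\<tau> y_KK = y_KK"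
    by blast
  then have "x_KK \<in> range \<tau>"
    by (intro step_poly_hom_range[OF hyps])
  then have "surj \<tau>"
    using surj_field_hom[OF \<tau>(1,2)] \<tau>(4) by (metis rangeI)
  with \<tau> that show ?thesis
    by blast
qed

section \<open>Generated fields and automorphism groups inside the algebraic closure\<close>

lemma KK_simps [simp]:
  "carrier KK = UNIV" "x \<otimes>\<^bsub>KK\<^esub> y = x * y" "x \<oplus>\<^bsub>KK\<^esub> y = x + y" "\<one>\<^bsub>KK\<^esub> = 1" "\<zero>\<^bsub>KK\<^esub> = 0"
  by (simp_all add: ring_of_type_algebra_def)

interpretation KK: cring KK
  by (rule cring_from_type_algebra)

lemma KK_a_inv: "\<ominus>\<^bsub>KK\<^esub> a = - a"
  using KK.minus_equality[of "- a" a] by simp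

lemma KK_m_inv: "a \<noteq> 0 \<Longrightarrow> inv\<^bsub>KK\<^esub> a = inverse a"
  by (rule KK.comm_inv_char) simp_all

lemma generate_KK_induct [consumes 1, case_names base one add uminus mult inverse]:
  assumes "a \<in> generate_field KK H"
    and "\<And>a. a \<in> H \<Longrightarrow> R a" "R 1" "\<And>a b. R a \<Longrightarrow> R b \<Longrightarrow> R (a + b)" "\<And>a. R a \<Longrightarrow> R (- a)"
    "\<And>a b. R a \<Longrightarrow> R b \<Longrightarrow> R (a * b)" "\<And>a. R a \<Longrightarrow> R (inverse a)"
  shows "R a"
  using assms(1) by induction (use assms(2-) in \<open>simp_all add: KK_a_inv KK_m_inv\<close>)

lemma generate_KK_closed:
  shows "1 \<in> generate_field KK H"
    and "a \<in> generate_field KK H \<Longrightarrow> b \<in> generate_field KK H \<Longrightarrow> a + b \<in> generate_field KK H"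
    and "a \<in> generate_field KK H \<Longrightarrow> - a \<in> generate_field KK H"
    and "a \<in> generate_field KK H \<Longrightarrow> b \<in> generate_field KK H \<Longrightarrow> a * b \<in> generate_field KK H"
    and "a \<in> generate_field KK H \<Longrightarrow> inverse a \<in> generate_field KK H"
proof -
  show "1 \<in> generate_field KK H"
    using generate_field.one[of KK H] by simp
  show "a + b \<in> generate_field KK H" if "a \<in> generate_field KK H" "b \<in> generate_field KK H"
    using generate_field.eng_add[OF that] by simp
  show "a * b \<in> generate_field KK H" if "a \<in> generate_field KK H" "b \<in> generate_field KK H"
    using generate_field.eng_mult[OF that] by simp
  show "- a \<in> generate_field KK H" if "a \<in> generate_field KK H"
    using generate_field.a_inv[OF that] by (simp add: KK_a_inv)
  show "inverse a \<in> generate_field KK H" if "a \<in> generate_field KK H"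
    using generate_field.m_inv[OF that] that by (cases "a = 0") (simp_all add: KK_m_inv)
qed

text \<open>The elements fixed by a homomorphism form a subfield.\<close>

lemma fixes_generate_KK:
  assumes \<tau>: "subfield_hom M \<tau>" and a: "a \<in> generate_field KK H"
    and H: "H \<subseteq> M" "\<And>a. a \<in> H \<Longrightarrow> \<tau> a = a"
  shows "a \<in> M \<and> \<tau> a = a"
proof -
  interpret subfield_hom M \<tau>
    by (rule \<tau>)
  show ?thesis
    using a by (induction rule: generate_KK_induct)
      (use H in \<open>auto simp: one_mem add_mem uminus_mem mult_mem inverse_mem
        hom_one hom_add hom_uminus hom_mult hom_inverse\<close>)
qed

lemma field_hom_generate_KK:
  assumes "field_hom \<tau>" "\<tau> ` H \<subseteq> generate_field KK H'"
  shows "\<tau> ` generate_field KK H \<subseteq> generate_field KK H'"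
proof (rule image_subsetI)
  interpret subfield_hom UNIV \<tau>
    by (rule assms(1))
  fix a assume "a \<in> generate_field KK H"
  then show "\<tau> a \<in> generate_field KK H'"
    by (induction rule: generate_KK_induct)
      (use assms(2) in \<open>auto simp: generate_KK_closed hom_one hom_add hom_uminus hom_mult hom_inverse\<close>)
qed

section \<open>Automorphism groups over a subfield\<close>

lemma mem_Aut_over:
  "\<sigma> \<in> carrier (Aut_over KK M L) \<longleftrightarrow> \<sigma> \<in> Bij M \<and> \<sigma> 1 = 1 \<and>
     (\<forall>a\<in>M. \<forall>b\<in>M. \<sigma> (a + b) = \<sigma> a + \<sigma> b \<and> \<sigma> (a * b) = \<sigma> a * \<sigma> b) \<and> (\<forall>a\<in>L. \<sigma> a = a)"
  by (auto simp: Aut_over_def ring_hom_def dest: Bij_imp_funcset)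

lemma Aut_over_mult:
  "\<sigma> \<in> Bij M \<Longrightarrow> \<tau> \<in> Bij M \<Longrightarrow> \<sigma> \<otimes>\<^bsub>Aut_over KK M L\<^esub> \<tau> = compose M \<sigma> \<tau>"
  by (simp add: Aut_over_def BijGroup_def)

lemma Aut_over_one: "\<one>\<^bsub>Aut_over KK M L\<^esub> = (\<lambda>a\<in>M. a)"
  by (simp add: Aut_over_def BijGroup_def)

lemma Aut_over_mem: "\<sigma> \<in> carrier (Aut_over KK M L) \<Longrightarrow> a \<in> M \<Longrightarrow> \<sigma> a \<in> M"
  unfolding mem_Aut_over by (auto dest: Bij_imp_funcset)

lemma Aut_over_subfield_hom:
  assumes "\<sigma> \<in> carrier (Aut_over KK (generate_field KK H) L)"
  shows "subfield_hom (generate_field KK H) \<sigma>"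
  using assms unfolding mem_Aut_over by unfold_locales (auto simp: generate_KK_closed)

lemma group_Aut_over:
  assumes M: "M = generate_field KK H" and "L \<subseteq> M"
  shows "group (Aut_over KK M L)"
proof -
  have "subgroup (carrier (Aut_over KK M L)) (BijGroup M)"
  proof (rule subgroup.intro)
    show "carrier (Aut_over KK M L) \<subseteq> carrier (BijGroup M)"
      by (auto simp: mem_Aut_over BijGroup_def)
  next
    fix \<sigma> \<tau> assume \<sigma>: "\<sigma> \<in> carrier (Aut_over KK M L)" and \<tau>: "\<tau> \<in> carrier (Aut_over KK M L)"
    have "compose M \<sigma> \<tau> \<in> carrier (Aut_over KK M L)"
      using \<sigma> \<tau> Aut_over_mem[OF \<tau>] generate_KK_closed[where H = H] \<open>L \<subseteq> M\<close> unfolding mem_Aut_over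
      by (auto simp: compose_Bij compose_eq M)
    then show "\<sigma> \<otimes>\<^bsub>BijGroup M\<^esub> \<tau> \<in> carrier (Aut_over KK M L)"
      using \<sigma> \<tau> by (simp add: mem_Aut_over BijGroup_def)
  next
    show "\<one>\<^bsub>BijGroup M\<^esub> \<in> carrier (Aut_over KK M L)"
      using \<open>L \<subseteq> M\<close> generate_KK_closed[where H = H]
      by (auto simp: mem_Aut_over BijGroup_def id_Bij M)
  next
    fix \<sigma> assume \<sigma>: "\<sigma> \<in> carrier (Aut_over KK M L)"
    then have bij: "\<sigma> \<in> Bij M" "inj_on \<sigma> M" "\<sigma> ` M = M"
      by (auto simp: mem_Aut_over Bij_def bij_betw_def)
    have inv: "inv_into M \<sigma> a = b" if "b \<in> M" "\<sigma> b = a" for a b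
      using that bij(2) by (auto simp: inv_into_f_f)
    have pre: "\<exists>b\<in>M. \<sigma> b = a" if "a \<in> M" for a
      using that bij(3) by (metis imageE)
    have "restrict (inv_into M \<sigma>) M \<in> carrier (Aut_over KK M L)"
      unfolding mem_Aut_over
    proof (intro conjI ballI)
      show "restrict (inv_into M \<sigma>) M \<in> Bij M"
        by (rule restrict_inv_into_Bij) fact
      show "restrict (inv_into M \<sigma>) M 1 = 1"
        using \<sigma> inv[of 1 1] generate_KK_closed(1)[of H] by (simp add: mem_Aut_over M)
    next
      fix a assume "a \<in> L"
      then show "restrict (inv_into M \<sigma>) M a = a"
        using \<sigma> inv[of a a] \<open>L \<subseteq> M\<close> by (auto simp: mem_Aut_over)
    next
      fix a b assume "a \<in> M" "b \<in> M"
      then obtain a' b' where *: "a' \<in> M" "\<sigma> a' = a" "b' \<in> M" "\<sigma> b' = b"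
        using pre by blast
      have "\<sigma> (a' + b') = a + b" "\<sigma> (a' * b') = a * b" "a' + b' \<in> M" "a' * b' \<in> M"
        using \<sigma> * generate_KK_closed[where H = H] by (auto simp: mem_Aut_over M)
      then show "restrict (inv_into M \<sigma>) M (a + b) = restrict (inv_into M \<sigma>) M a + restrict (inv_into M \<sigma>) M b"
        "restrict (inv_into M \<sigma>) M (a * b) = restrict (inv_into M \<sigma>) M a * restrict (inv_into M \<sigma>) M b"
        using * inv \<open>a \<in> M\<close> \<open>b \<in> M\<close> generate_KK_closed[where H = H] by (auto simp: M)
    qed
    then show "inv\<^bsub>BijGroup M\<^esub> \<sigma> \<in> carrier (Aut_over KK M L)"
      using bij(1) by (simp add: inv_BijGroup)
  qed
  then have "group (BijGroup M\<lparr>carrier := carrier (Aut_over KK M L)\<rparr>)"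
    using group_BijGroup by (rule subgroup.subgroup_is_group)
  then show ?thesis
    by (simp add: Aut_over_def)
qed

section \<open>The action on the orbit\<close>

lemma x_KK_nonzero: "x_KK \<noteq> 0" and y_KK_nonzero: "y_KK \<noteq> 0"
  by (simp_all add: x_KK_def y_KK_def)

lemma adjacent_sym: "adjacent \<S> w p q \<Longrightarrow> adjacent \<S> w q p"
  by (auto simp: adjacent_def x_adjacent_def y_adjacent_def step_poly_eq_def)

context
  fixes \<S> :: "(int \<times> int) set" and w :: "int \<times> int \<Rightarrow> complex"
  assumes fin: "finite \<S>" and w: "\<forall>s\<in>\<S>. w s \<noteq> 0" and nonuni: "not_univariate \<S>"
begin

text \<open>The transitive closure asks for at least one step. The loop at (x, y) supplies it, since
  x and y are nonzero and S is therefore defined there.\<close>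

lemma xy_in_orbit: "(x_KK, y_KK) \<in> walk_orbit \<S> w"
proof -
  have "adjacent \<S> w (x_KK, y_KK) (x_KK, y_KK)"
    by (simp add: adjacent_def x_adjacent_def step_poly_eq_def step_poly_defined_def
        x_KK_nonzero y_KK_nonzero)
  then show ?thesis
    by (auto simp: walk_orbit_def)
qed

lemma adjacent_in_orbit:
  assumes "adjacent \<S> w p q" "q \<in> walk_orbit \<S> w"
  shows "p \<in> walk_orbit \<S> w"
  using assms unfolding walk_orbit_def by (blast intro: tranclp_into_tranclp2)

text \<open>A path is read back from its end (x, y). A path with a single edge is itself a
  \<open>step\<close> from (x, y), so (x, y) is the only base case.\<close>

lemma orbit_induct [consumes 1, case_names base step]:
  assumes "p \<in> walk_orbit \<S> w"
    and base: "R (x_KK, y_KK)"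
    and step: "\<And>p q. adjacent \<S> w p q \<Longrightarrow> q \<in> walk_orbit \<S> w \<Longrightarrow> R q \<Longrightarrow> R p"
  shows "R p"
proof -
  have "(adjacent \<S> w)\<^sup>+\<^sup>+ p (x_KK, y_KK)"
    using assms(1) by (simp add: walk_orbit_def)
  then show ?thesis
  proof (induction rule: converse_tranclp_induct)
    case (base p)
    then show ?case
      using assms(2) step xy_in_orbit by blast
  next
    case (step p q)
    then show ?case
      using assms(3)[of p q] by (simp add: walk_orbit_def)
  qed
qed

lemma k_orbit_eq: "k_orbit \<S> w =
    generate_field KK (k_base \<S> w \<union> (fst ` walk_orbit \<S> w \<union> snd ` walk_orbit \<S> w))"
  by (simp add: k_orbit_def k_adjoin_def)

lemma k_base_subset: "k_base \<S> w \<subseteq> k_orbit \<S> w"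
  unfolding k_orbit_eq by (auto intro: generate_field.incl)

lemma orbit_subset: "walk_orbit \<S> w \<subseteq> k_orbit \<S> w \<times> k_orbit \<S> w"
  unfolding k_orbit_eq by (force intro: generate_field.incl)

lemma x_y_in_k_orbit: "x_KK \<in> k_orbit \<S> w" "y_KK \<in> k_orbit \<S> w"
  using xy_in_orbit orbit_subset by auto

lemma const_in_k_base: "const_KK c \<in> k_base \<S> w"
  unfolding k_base_def by (auto intro: generate_field.incl)

lemma step_poly_in_k_base: "step_poly \<S> w (x_KK, y_KK) \<in> k_base \<S> w"
  unfolding k_base_def by (auto intro: generate_field.incl)

lemma k_base_subset_adjoin: "k_base \<S> w \<subseteq> k_adjoin \<S> w A"
  unfolding k_adjoin_def by (auto intro: generate_field.incl)

lemma subset_adjoin: "A \<subseteq> k_adjoin \<S> w A"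
  unfolding k_adjoin_def by (auto intro: generate_field.incl)

lemma k_adjoin_subset:
  assumes "A \<subseteq> k_orbit \<S> w"
  shows "k_adjoin \<S> w A \<subseteq> k_orbit \<S> w"
proof
  have "k_base \<S> w \<union> A \<subseteq> k_orbit \<S> w"
    using assms k_base_subset by blast
  fix a assume "a \<in> k_adjoin \<S> w A"
  then show "a \<in> k_orbit \<S> w"
    unfolding k_adjoin_def
    by (induction rule: generate_KK_induct)
      (use \<open>k_base \<S> w \<union> A \<subseteq> k_orbit \<S> w\<close> in \<open>auto simp: k_orbit_eq generate_KK_closed\<close>)
qed

section \<open>Homomorphisms acting on the orbit\<close>

text \<open>Injectivity keeps nonzero coordinates nonzero, so S stays defined; equality of its two
  values is transported by \<open>hom_step_poly\<close>.\<close>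

lemma adjacent_hom:
  assumes "subfield_hom M \<tau>" "\<And>c. const_KK c \<in> M" "\<And>c. \<tau> (const_KK c) = const_KK c"
    and pq: "p \<in> M \<times> M" "q \<in> M \<times> M" and adj: "adjacent \<S> w p q"
  shows "adjacent \<S> w (map_prod \<tau> \<tau> p) (map_prod \<tau> \<tau> q)"
proof -
  interpret subfield_hom M \<tau>
    by fact
  obtain u v u' v' where [simp]: "p = (u, v)" "q = (u', v')"
    by (cases p, cases q)
  have "u \<in> M" "v \<in> M" "u' \<in> M" "v' \<in> M"
    using pq by auto
  with adj show ?thesis
    by (auto simp: adjacent_def x_adjacent_def y_adjacent_def step_poly_eq_def step_poly_defined_def
        hom_eq_0_iff simp flip: hom_step_poly[OF assms(1-3)])
qed

lemma hom_orbit_subset: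
  assumes "subfield_hom M \<tau>" "\<And>c. const_KK c \<in> M" "\<And>c. \<tau> (const_KK c) = const_KK c"
    and "walk_orbit \<S> w \<subseteq> M \<times> M" and "(\<tau> x_KK, \<tau> y_KK) \<in> walk_orbit \<S> w"
    and "p \<in> walk_orbit \<S> w"
  shows "map_prod \<tau> \<tau> p \<in> walk_orbit \<S> w"
  using assms(6)
proof (induction rule: orbit_induct)
  case base
  then show ?case
    using assms(5) by simp
next
  case (step p q)
  then have "p \<in> M \<times> M" "q \<in> M \<times> M"
    using assms(4) adjacent_in_orbit by blast+
  then show ?case
    using step assms(1-3) by (intro adjacent_in_orbit[OF adjacent_hom step.IH])
qed

text \<open>Adjacency gives S(\<tau> x, \<tau> y) = S(x, y), so \<tau> fixes k. For an infinite
  orbit, mapping it into itself does not yet give surjectivity on k(O); therefore the inverse \<rho>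
  is shown to preserve the orbit too.\<close>

lemma automorphism_restrict:
  assumes \<tau>: "field_hom \<tau>" "surj \<tau>" and const: "\<And>c. \<tau> (const_KK c) = const_KK c"
    and adj: "adjacent \<S> w (\<tau> x_KK, \<tau> y_KK) (x_KK, y_KK)"
    and A: "A \<subseteq> k_orbit \<S> w" "\<And>a. a \<in> A \<Longrightarrow> \<tau> a = a"
  shows "restrict \<tau> (k_orbit \<S> w) \<in> carrier (Aut_over KK (k_orbit \<S> w) (k_adjoin \<S> w A))"
proof -
  let ?M = "k_orbit \<S> w"
  interpret \<tau>: subfield_hom UNIV \<tau>
    by (rule \<tau>(1))
  define \<rho> where "\<rho> = inv_into UNIV \<tau>"
  have \<tau>\<rho>: "\<tau> (\<rho> a) = a" for a
    using \<tau>(2) by (simp add: \<rho>_def surj_f_inv_f)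
  have inj: "\<tau> a = \<tau> b \<longleftrightarrow> a = b" for a b
    by (simp add: \<tau>.hom_eq_iff)
  have \<rho>\<tau>: "\<rho> (\<tau> a) = a" for a
    using \<tau>\<rho>[of "\<tau> a"] by (simp add: inj)
  have \<rho>: "field_hom \<rho>"
    by (rule field_homI) (simp_all add: \<tau>\<rho> \<tau>.hom_one \<tau>.hom_add \<tau>.hom_mult flip: inj)
  have const\<rho>: "\<rho> (const_KK c) = const_KK c" for c
    by (metis \<rho>\<tau> const)
  have t: "\<tau> (step_poly \<S> w (x_KK, y_KK)) = step_poly \<S> w (x_KK, y_KK)"
    using adj by (auto simp: hom_step_poly[OF \<tau>(1)] const adjacent_def x_adjacent_def y_adjacent_def step_poly_eq_def)
  have t\<rho>: "\<rho> (step_poly \<S> w (x_KK, y_KK)) = step_poly \<S> w (x_KK, y_KK)"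
    by (metis \<rho>\<tau> t)
  \<comment> \<open>Stated for a general \<eta>, to serve both \<tau> and \<rho>; likewise
    \<open>sub\<close>.\<close>
  have base: "\<eta> a = a" if "field_hom \<eta>" "\<And>c. \<eta> (const_KK c) = const_KK c"
      "\<eta> (step_poly \<S> w (x_KK, y_KK)) = step_poly \<S> w (x_KK, y_KK)" "a \<in> k_base \<S> w" for \<eta> a
    using fixes_generate_KK[OF that(1) that(4)[unfolded k_base_def]] that(2,3) by auto
  have sub: "\<eta> ` ?M \<subseteq> ?M" if "field_hom \<eta>" "\<And>c. \<eta> (const_KK c) = const_KK c"
      "\<eta> (step_poly \<S> w (x_KK, y_KK)) = step_poly \<S> w (x_KK, y_KK)"
      "(\<eta> x_KK, \<eta> y_KK) \<in> walk_orbit \<S> w" for \<eta>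
  proof -
    have "(\<eta> u, \<eta> v) \<in> ?M \<times> ?M" if "(u, v) \<in> walk_orbit \<S> w" for u v
      using hom_orbit_subset[OF \<open>field_hom \<eta>\<close> UNIV_I \<open>\<And>c. \<eta> (const_KK c) = const_KK c\<close> _ _ that]
        \<open>(\<eta> x_KK, \<eta> y_KK) \<in> walk_orbit \<S> w\<close> orbit_subset by auto
    moreover have "\<eta> a \<in> ?M" if "a \<in> k_base \<S> w" for a
      using base[of \<eta> a] that \<open>field_hom \<eta>\<close> \<open>\<And>c. \<eta> (const_KK c) = const_KK c\<close> k_base_subset
        \<open>\<eta> (step_poly \<S> w (x_KK, y_KK)) = step_poly \<S> w (x_KK, y_KK)\<close> by auto
    ultimately have "\<eta> ` (k_base \<S> w \<union> (fst ` walk_orbit \<S> w \<union> snd ` walk_orbit \<S> w)) \<subseteq> ?M"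
      by auto
    then show ?thesis
      unfolding k_orbit_eq by (rule field_hom_generate_KK[OF \<open>field_hom \<eta>\<close>])
  qed
  have "(\<tau> x_KK, \<tau> y_KK) \<in> walk_orbit \<S> w"
    by (rule adjacent_in_orbit[OF adj xy_in_orbit])
  then have \<tau>M: "\<tau> ` ?M \<subseteq> ?M"
    by (intro sub \<tau> const t)
  \<comment> \<open>Applying \<rho> to the given adjacency moves \<tau>(x, y) to (x, y) and (x, y)
    to \<rho>(x, y).\<close>
  have "adjacent \<S> w (\<rho> x_KK, \<rho> y_KK) (x_KK, y_KK)"
    using adjacent_hom[OF \<rho> UNIV_I const\<rho> _ _ adj] by (simp add: \<rho>\<tau> adjacent_sym)
  then have "(\<rho> x_KK, \<rho> y_KK) \<in> walk_orbit \<S> w"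
    by (rule adjacent_in_orbit[OF _ xy_in_orbit])
  then have \<rho>M: "\<rho> ` ?M \<subseteq> ?M"
    by (intro sub \<rho> const\<rho> t\<rho>)
  have "?M \<subseteq> \<tau> ` ?M"
  proof
    fix a assume "a \<in> ?M"
    then have "\<rho> a \<in> ?M"
      using \<rho>M by blast
    then show "a \<in> \<tau> ` ?M"
      using \<tau>\<rho>[of a] by (metis imageI)
  qed
  then have "bij_betw \<tau> ?M ?M"
    using \<tau>M by (auto simp: bij_betw_def inj_on_def inj)
  then have "restrict \<tau> ?M \<in> Bij ?M"
    by (simp add: Bij_def cong: bij_betw_cong)
  moreover have "\<tau> a = a" if "a \<in> k_adjoin \<S> w A" for a
    using fixes_generate_KK[OF \<tau>(1) that[unfolded k_adjoin_def]] base[OF \<tau>(1) const t] A(2) by auto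
  ultimately show ?thesis
    unfolding mem_Aut_over using k_adjoin_subset[OF A(1)]
    by (auto simp: k_orbit_eq generate_KK_closed \<tau>.hom_one \<tau>.hom_add \<tau>.hom_mult)
qed

lemma ex_G_x:
  assumes "x_adjacent \<S> w p (x_KK, y_KK)"
  obtains \<sigma> where "\<sigma> \<in> carrier (G_x \<S> w)" "map_prod \<sigma> \<sigma> (x_KK, y_KK) = p"
proof -
  obtain v where p: "p = (x_KK, v)" and v: "step_poly \<S> w (x_KK, v) = step_poly \<S> w (x_KK, y_KK)"
    using assms by (cases p) (auto simp: x_adjacent_def step_poly_eq_def)
  obtain \<tau> where \<tau>: "field_hom \<tau>" "surj \<tau>" "\<And>c. \<tau> (const_KK c) = const_KK c"
      "\<tau> x_KK = x_KK" "\<tau> y_KK = v"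
    using ex_automorphism_x[OF fin w _ v] nonuni unfolding not_univariate_def by blast
  have "adjacent \<S> w (\<tau> x_KK, \<tau> y_KK) (x_KK, y_KK)"
    using assms by (simp add: adjacent_def \<tau>(4,5) p)
  from automorphism_restrict[OF \<tau>(1-3) this, of "{x_KK}"]
  have "restrict \<tau> (k_orbit \<S> w) \<in> carrier (G_x \<S> w)"
    by (simp add: G_x_def \<tau>(4) x_y_in_k_orbit)
  then show ?thesis
    using that by (simp add: p \<tau>(4,5) x_y_in_k_orbit)
qed

lemma ex_G_y:
  assumes "y_adjacent \<S> w p (x_KK, y_KK)"
  obtains \<sigma> where "\<sigma> \<in> carrier (G_y \<S> w)" "map_prod \<sigma> \<sigma> (x_KK, y_KK) = p"
proof -
  obtain u where p: "p = (u, y_KK)" and u: "step_poly \<S> w (u, y_KK) = step_poly \<S> w (x_KK, y_KK)"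
    using assms by (cases p) (auto simp: y_adjacent_def step_poly_eq_def)
  obtain \<tau> where \<tau>: "field_hom \<tau>" "surj \<tau>" "\<And>c. \<tau> (const_KK c) = const_KK c"
      "\<tau> x_KK = u" "\<tau> y_KK = y_KK"
    using ex_automorphism_y[OF fin w _ u] nonuni unfolding not_univariate_def by blast
  have "adjacent \<S> w (\<tau> x_KK, \<tau> y_KK) (x_KK, y_KK)"
    using assms by (simp add: adjacent_def \<tau>(4,5) p)
  from automorphism_restrict[OF \<tau>(1-3) this, of "{y_KK}"]
  have "restrict \<tau> (k_orbit \<S> w) \<in> carrier (G_y \<S> w)"
    by (simp add: G_y_def \<tau>(5) x_y_in_k_orbit)
  then show ?thesis
    using that by (simp add: p \<tau>(4,5) x_y_in_k_orbit)
qed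

abbreviation "Aut_k \<equiv> Aut_over KK (k_orbit \<S> w) (k_base \<S> w)"

lemma group_Aut_k: "group Aut_k"
  by (rule group_Aut_over[OF k_orbit_eq k_base_subset])

lemma Aut_k_subfield_hom: "\<sigma> \<in> carrier Aut_k \<Longrightarrow> subfield_hom (k_orbit \<S> w) \<sigma>"
  unfolding k_orbit_eq by (rule Aut_over_subfield_hom)

lemma Aut_k_const: "\<sigma> \<in> carrier Aut_k \<Longrightarrow> \<sigma> (const_KK c) = const_KK c"
  using const_in_k_base by (simp add: mem_Aut_over)

lemma const_in_k_orbit: "const_KK c \<in> k_orbit \<S> w"
  using const_in_k_base k_base_subset by blast

lemma G_x_subset: "carrier (G_x \<S> w) \<subseteq> carrier Aut_k"
  using subsetD[OF k_base_subset_adjoin[of "{x_KK}"]] unfolding G_x_def by (auto simp: mem_Aut_over)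

lemma G_y_subset: "carrier (G_y \<S> w) \<subseteq> carrier Aut_k"
  using subsetD[OF k_base_subset_adjoin[of "{y_KK}"]] unfolding G_y_def by (auto simp: mem_Aut_over)

lemma G_x_x: "\<sigma> \<in> carrier (G_x \<S> w) \<Longrightarrow> \<sigma> x_KK = x_KK"
  using subset_adjoin[of "{x_KK}"] by (simp add: G_x_def mem_Aut_over)

lemma G_y_y: "\<sigma> \<in> carrier (G_y \<S> w) \<Longrightarrow> \<sigma> y_KK = y_KK"
  using subset_adjoin[of "{y_KK}"] by (simp add: G_y_def mem_Aut_over)

text \<open>S(x, y) lies in k and is fixed, so S has the same value at (x, y) and at its image; a
  fixed coordinate then makes the two pairs adjacent.\<close>

lemma Aut_k_adjacent:
  assumes \<sigma>: "\<sigma> \<in> carrier Aut_k" and "\<sigma> x_KK = x_KK \<or> \<sigma> y_KK = y_KK"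
  shows "adjacent \<S> w (\<sigma> x_KK, \<sigma> y_KK) (x_KK, y_KK)"
proof -
  interpret subfield_hom "k_orbit \<S> w" \<sigma>
    by (rule Aut_k_subfield_hom[OF \<sigma>])
  have "\<sigma> (step_poly \<S> w (x_KK, y_KK)) = step_poly \<S> w (x_KK, y_KK)"
    using \<sigma> step_poly_in_k_base by (simp add: mem_Aut_over)
  moreover have "\<sigma> (step_poly \<S> w (x_KK, y_KK)) = step_poly \<S> w (\<sigma> x_KK, \<sigma> y_KK)"
    by (intro hom_step_poly[OF subfield_hom_axioms] const_in_k_orbit Aut_k_const \<sigma> x_y_in_k_orbit)
  moreover have "\<sigma> x_KK \<noteq> 0" "\<sigma> y_KK \<noteq> 0"
    by (simp_all add: hom_eq_0_iff x_y_in_k_orbit x_KK_nonzero y_KK_nonzero)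
  ultimately show ?thesis
    using assms(2) by (auto simp: adjacent_def x_adjacent_def y_adjacent_def step_poly_eq_def
        step_poly_defined_def x_KK_nonzero y_KK_nonzero)
qed

lemma Aut_k_inverse:
  assumes \<sigma>: "\<sigma> \<in> carrier Aut_k"
  shows "inv\<^bsub>Aut_k\<^esub> \<sigma> \<in> carrier Aut_k"
    and "a \<in> k_orbit \<S> w \<Longrightarrow> (inv\<^bsub>Aut_k\<^esub> \<sigma>) (\<sigma> a) = a"
    and "a \<in> k_orbit \<S> w \<Longrightarrow> \<sigma> ((inv\<^bsub>Aut_k\<^esub> \<sigma>) a) = a"
proof -
  interpret group Aut_k
    by (rule group_Aut_k)
  show inv: "inv\<^bsub>Aut_k\<^esub> \<sigma> \<in> carrier Aut_k"
    using \<sigma> by simp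
  have Bij: "\<sigma> \<in> Bij (k_orbit \<S> w)" "inv\<^bsub>Aut_k\<^esub> \<sigma> \<in> Bij (k_orbit \<S> w)"
    using \<sigma> inv by (simp_all add: mem_Aut_over)
  show "(inv\<^bsub>Aut_k\<^esub> \<sigma>) (\<sigma> a) = a" if "a \<in> k_orbit \<S> w"
    using that fun_cong[OF l_inv[OF \<sigma>], of a]
    by (simp add: Aut_over_mult[OF Bij(2,1)] Aut_over_one compose_eq)
  show "\<sigma> ((inv\<^bsub>Aut_k\<^esub> \<sigma>) a) = a" if "a \<in> k_orbit \<S> w"
    using that fun_cong[OF r_inv[OF \<sigma>], of a]
    by (simp add: Aut_over_mult[OF Bij] Aut_over_one compose_eq)
qed

text \<open>The inverse of \<sigma> fixes the same coordinate, so both map the orbit into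
  itself.\<close>

lemma Aut_k_image_orbit:
  assumes \<sigma>: "\<sigma> \<in> carrier Aut_k" and xy: "\<sigma> x_KK = x_KK \<or> \<sigma> y_KK = y_KK"
  shows "map_prod \<sigma> \<sigma> ` walk_orbit \<S> w = walk_orbit \<S> w"
proof -
  have sub: "map_prod \<tau> \<tau> p \<in> walk_orbit \<S> w"
    if "\<tau> \<in> carrier Aut_k" "\<tau> x_KK = x_KK \<or> \<tau> y_KK = y_KK" "p \<in> walk_orbit \<S> w" for \<tau> p
    using adjacent_in_orbit[OF Aut_k_adjacent[OF that(1,2)] xy_in_orbit] that(3)
    by (rule hom_orbit_subset[OF Aut_k_subfield_hom[OF that(1)] const_in_k_orbit
          Aut_k_const[OF that(1)] orbit_subset])
  define \<rho> where "\<rho> = inv\<^bsub>Aut_k\<^esub> \<sigma>"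
  note \<rho> = Aut_k_inverse[OF \<sigma>, folded \<rho>_def]
  have "\<rho> x_KK = x_KK \<or> \<rho> y_KK = y_KK"
    using xy \<rho>(2)[OF x_y_in_k_orbit(1)] \<rho>(2)[OF x_y_in_k_orbit(2)] by auto
  note sub\<rho> = sub[OF \<rho>(1) this]
  show ?thesis
  proof (intro equalityI image_subsetI subsetI)
    fix p assume p: "p \<in> walk_orbit \<S> w"
    show "map_prod \<sigma> \<sigma> p \<in> walk_orbit \<S> w"
      by (rule sub[OF \<sigma> xy p])
    have "p = map_prod \<sigma> \<sigma> (map_prod \<rho> \<rho> p)"
      using p orbit_subset by (cases p) (auto simp: \<rho>(3))
    then show "p \<in> map_prod \<sigma> \<sigma> ` walk_orbit \<S> w"
      using sub\<rho>[OF p] by (rule image_eqI)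
  qed
qed

section \<open>The walk group as a group of permutations of the orbit\<close>

lemma walk_group_carrier:
  "carrier (walk_group \<S> w) = generate Aut_k (carrier (G_x \<S> w) \<union> carrier (G_y \<S> w))"
  by (simp add: walk_group_def Let_def)

lemma subgroup_walk_group: "subgroup (carrier (walk_group \<S> w)) Aut_k"
  unfolding walk_group_carrier using G_x_subset G_y_subset
  by (intro group.generate_is_subgroup group_Aut_k) blast

lemma walk_group_eq: "walk_group \<S> w = Aut_k\<lparr>carrier := carrier (walk_group \<S> w)\<rparr>"
  by (simp add: walk_group_def Let_def)

lemma group_walk_group: "group (walk_group \<S> w)"
  using subgroup.subgroup_is_group[OF subgroup_walk_group group_Aut_k] walk_group_eq by simp

lemma walk_group_mem: "\<sigma> \<in> carrier (walk_group \<S> w) \<Longrightarrow> \<sigma> \<in> carrier Aut_k"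
  using subgroup.subset[OF subgroup_walk_group] by blast

lemma walk_group_mult:
  assumes "\<sigma> \<in> carrier (walk_group \<S> w)" "\<tau> \<in> carrier (walk_group \<S> w)"
  shows "\<sigma> \<otimes>\<^bsub>walk_group \<S> w\<^esub> \<tau> = compose (k_orbit \<S> w) \<sigma> \<tau>"
proof -
  have "\<sigma> \<otimes>\<^bsub>walk_group \<S> w\<^esub> \<tau> = \<sigma> \<otimes>\<^bsub>Aut_k\<^esub> \<tau>"
    by (subst walk_group_eq) simp
  also have "\<dots> = compose (k_orbit \<S> w) \<sigma> \<tau>"
    using assms[THEN walk_group_mem] by (intro Aut_over_mult) (simp_all add: mem_Aut_over)
  finally show ?thesis .
qed

lemma map_prod_compose:
  assumes "p \<in> walk_orbit \<S> w"
  shows "map_prod (compose (k_orbit \<S> w) \<sigma> \<tau>) (compose (k_orbit \<S> w) \<sigma> \<tau>) p = map_prod \<sigma> \<sigma> (map_prod \<tau> \<tau> p)"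
  using assms orbit_subset by (cases p) (auto simp: compose_eq)

text \<open>Equality instead of inclusion is what inverses of generators inherit, and what
  bijectivity of the action requires.\<close>

lemma walk_group_image_orbit:
  assumes "\<sigma> \<in> carrier (walk_group \<S> w)"
  shows "map_prod \<sigma> \<sigma> ` walk_orbit \<S> w = walk_orbit \<S> w"
  using assms unfolding walk_group_carrier
proof (induction rule: generate.induct)
  case one
  have "map_prod (\<lambda>a\<in>k_orbit \<S> w. a) (\<lambda>a\<in>k_orbit \<S> w. a) p = p" if "p \<in> walk_orbit \<S> w" for p
    using that orbit_subset by (cases p) auto
  then have "map_prod (\<lambda>a\<in>k_orbit \<S> w. a) (\<lambda>a\<in>k_orbit \<S> w. a) ` walk_orbit \<S> w = (\<lambda>p. p) ` walk_orbit \<S> w"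
    by (intro image_cong refl)
  then show ?case
    by (simp only: Aut_over_one image_ident)
next
  case (incl \<sigma>)
  then show ?case
    using G_x_subset G_y_subset G_x_x G_y_y by (intro Aut_k_image_orbit) blast+
next
  case (inv \<sigma>)
  then have \<sigma>: "\<sigma> \<in> carrier Aut_k"
    using G_x_subset G_y_subset by blast
  have "map_prod \<sigma> \<sigma> ` walk_orbit \<S> w = walk_orbit \<S> w"
    using inv \<sigma> G_x_x G_y_y by (intro Aut_k_image_orbit) blast+
  then have "map_prod (inv\<^bsub>Aut_k\<^esub> \<sigma>) (inv\<^bsub>Aut_k\<^esub> \<sigma>) ` walk_orbit \<S> w =
      map_prod (inv\<^bsub>Aut_k\<^esub> \<sigma>) (inv\<^bsub>Aut_k\<^esub> \<sigma>) ` map_prod \<sigma> \<sigma> ` walk_orbit \<S> w"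
    by simp
  also have "\<dots> = (\<lambda>p. p) ` walk_orbit \<S> w"
    unfolding image_image using orbit_subset Aut_k_inverse(2)[OF \<sigma>]
    by (intro image_cong refl) auto
  finally show ?case
    by simp
next
  case (eng \<sigma> \<tau>)
  then have "\<sigma> \<in> carrier Aut_k" "\<tau> \<in> carrier Aut_k"
    using walk_group_mem by (auto simp: walk_group_carrier)
  then have "\<sigma> \<otimes>\<^bsub>Aut_k\<^esub> \<tau> = compose (k_orbit \<S> w) \<sigma> \<tau>"
    by (intro Aut_over_mult) (simp_all add: mem_Aut_over)
  then have "map_prod (\<sigma> \<otimes>\<^bsub>Aut_k\<^esub> \<tau>) (\<sigma> \<otimes>\<^bsub>Aut_k\<^esub> \<tau>) ` walk_orbit \<S> w =
      map_prod \<sigma> \<sigma> ` map_prod \<tau> \<tau> ` walk_orbit \<S> w"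
    unfolding image_image by (intro image_cong refl) (simp only: map_prod_compose)
  then show ?case
    using eng.IH by simp
qed

lemma walk_action_apply:
  "p \<in> walk_orbit \<S> w \<Longrightarrow> walk_action \<S> w \<sigma> p = map_prod \<sigma> \<sigma> p"
  by (simp add: walk_action_def map_prod_def case_prod_unfold)

lemma walk_action_Bij:
  assumes \<sigma>: "\<sigma> \<in> carrier (walk_group \<S> w)"
  shows "walk_action \<S> w \<sigma> \<in> Bij (walk_orbit \<S> w)"
proof -
  interpret subfield_hom "k_orbit \<S> w" \<sigma>
    by (rule Aut_k_subfield_hom[OF walk_group_mem[OF \<sigma>]])
  have "inj_on (map_prod \<sigma> \<sigma>) (k_orbit \<S> w \<times> k_orbit \<S> w)"
    by (auto simp: inj_on_def hom_eq_iff)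
  then have "inj_on (map_prod \<sigma> \<sigma>) (walk_orbit \<S> w)"
    using orbit_subset by (rule inj_on_subset)
  then have "bij_betw (map_prod \<sigma> \<sigma>) (walk_orbit \<S> w) (walk_orbit \<S> w)"
    using walk_group_image_orbit[OF \<sigma>] by (simp add: bij_betw_def)
  then have "bij_betw (walk_action \<S> w \<sigma>) (walk_orbit \<S> w) (walk_orbit \<S> w)"
    by (simp add: walk_action_apply cong: bij_betw_cong)
  then show ?thesis
    by (simp add: Bij_def walk_action_def)
qed

lemma group_action_walk_group: "group_action (walk_group \<S> w) (walk_orbit \<S> w) (walk_action \<S> w)"
  unfolding group_action_def group_hom_def group_hom_axioms_def
proof (intro conjI group_walk_group group_BijGroup homI)
  fix \<sigma> assume "\<sigma> \<in> carrier (walk_group \<S> w)"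
  then show "walk_action \<S> w \<sigma> \<in> carrier (BijGroup (walk_orbit \<S> w))"
    by (simp add: BijGroup_def walk_action_Bij)
next
  fix \<sigma> \<tau> assume \<sigma>: "\<sigma> \<in> carrier (walk_group \<S> w)" and \<tau>: "\<tau> \<in> carrier (walk_group \<S> w)"
  have "walk_action \<S> w (compose (k_orbit \<S> w) \<sigma> \<tau>) =
      compose (walk_orbit \<S> w) (walk_action \<S> w \<sigma>) (walk_action \<S> w \<tau>)"
  proof (rule extensionalityI)
    show "walk_action \<S> w (compose (k_orbit \<S> w) \<sigma> \<tau>) \<in> extensional (walk_orbit \<S> w)"
      by (simp add: walk_action_def)
    show "compose (walk_orbit \<S> w) (walk_action \<S> w \<sigma>) (walk_action \<S> w \<tau>) \<in> extensional (walk_orbit \<S> w)"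
      by (simp add: compose_def)
    fix p assume p: "p \<in> walk_orbit \<S> w"
    then have "map_prod \<tau> \<tau> p \<in> walk_orbit \<S> w"
      using walk_group_image_orbit[OF \<tau>] by blast
    with p show "walk_action \<S> w (compose (k_orbit \<S> w) \<sigma> \<tau>) p =
        compose (walk_orbit \<S> w) (walk_action \<S> w \<sigma>) (walk_action \<S> w \<tau>) p"
      by (simp add: compose_eq walk_action_apply map_prod_compose)
  qed
  then show "walk_action \<S> w (\<sigma> \<otimes>\<^bsub>walk_group \<S> w\<^esub> \<tau>) =
      walk_action \<S> w \<sigma> \<otimes>\<^bsub>BijGroup (walk_orbit \<S> w)\<^esub> walk_action \<S> w \<tau>"
    using \<sigma> \<tau> by (simp add: walk_group_mult BijGroup_def walk_action_Bij)
qed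

section \<open>Coset representatives and transitivity\<close>

lemma coset_rep_x_y:
  assumes reps: "left_coset_reps G (G_xy \<S> w) I" and \<sigma>: "\<sigma> \<in> carrier G"
    and G: "G = G_x \<S> w \<or> G = G_y \<S> w"
  obtains i where "i \<in> I" "map_prod i i (x_KK, y_KK) = map_prod \<sigma> \<sigma> (x_KK, y_KK)"
proof -
  have "\<sigma> <#\<^bsub>G\<^esub> G_xy \<S> w \<in> lcosets\<^bsub>G\<^esub> (G_xy \<S> w)"
    using \<sigma> by (auto simp: LCOSETS_def)
  then obtain i where "i \<in> I" "i \<in> \<sigma> <#\<^bsub>G\<^esub> G_xy \<S> w"
    using reps unfolding left_coset_reps_def by blast
  then obtain h where h: "h \<in> G_xy \<S> w" "i = \<sigma> \<otimes>\<^bsub>G\<^esub> h"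
    by (auto simp: l_coset_def)
  have "\<sigma> \<in> Bij (k_orbit \<S> w)" "h \<in> Bij (k_orbit \<S> w)"
    using \<sigma> h(1) G by (auto simp: G_xy_def G_x_def G_y_def mem_Aut_over)
  then have "i = compose (k_orbit \<S> w) \<sigma> h"
    using h(2) G by (auto simp: G_x_def G_y_def Aut_over_mult)
  then have "map_prod i i (x_KK, y_KK) = map_prod \<sigma> \<sigma> (x_KK, y_KK)"
    using h(1) G_x_x[of h] G_y_y[of h] x_y_in_k_orbit by (simp add: compose_eq G_xy_def)
  with \<open>i \<in> I\<close> show ?thesis
    by (rule that)
qed

lemma transitive_walk_action:
  assumes Ix: "left_coset_reps (G_x \<S> w) (G_xy \<S> w) I\<^sub>x"
    and Iy: "left_coset_reps (G_y \<S> w) (G_xy \<S> w) I\<^sub>y"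
  defines "H \<equiv> generate (walk_group \<S> w) (I\<^sub>x \<union> I\<^sub>y)"
  shows "subgroup H (walk_group \<S> w)"
    and "transitive_action (walk_group \<S> w\<lparr>carrier := H\<rparr>) (walk_orbit \<S> w) (walk_action \<S> w)"
proof -
  interpret W: group "walk_group \<S> w"
    by (rule group_walk_group)
  interpret act: group_action "walk_group \<S> w" "walk_orbit \<S> w" "walk_action \<S> w"
    by (rule group_action_walk_group)
  have I: "I\<^sub>x \<union> I\<^sub>y \<subseteq> carrier (walk_group \<S> w)"
    using Ix Iy unfolding left_coset_reps_def walk_group_carrier by (auto intro: generate.incl)
  show H: "subgroup H (walk_group \<S> w)"
    unfolding H_def by (rule W.generate_is_subgroup[OF I])
  interpret H: subgroup H "walk_group \<S> w"
    by (rule H)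
  have xy: "\<exists>g\<in>H. walk_action \<S> w g (x_KK, y_KK) = p" if "p \<in> walk_orbit \<S> w" for p
    using that
  proof (induction rule: orbit_induct)
    case base
    show ?case
      using act.id_eq_one xy_in_orbit H.one_closed by (metis restrict_apply')
  next
    case (step p q)
    then obtain g where g: "g \<in> H" "walk_action \<S> w g (x_KK, y_KK) = q"
      by blast
    have p: "p \<in> walk_orbit \<S> w"
      by (rule adjacent_in_orbit) fact+
    define \<rho> where "\<rho> = inv\<^bsub>walk_group \<S> w\<^esub> g"
    have g\<rho>: "g \<in> carrier (walk_group \<S> w)" "\<rho> \<in> carrier (walk_group \<S> w)"
      using g(1) H.subset by (auto simp: \<rho>_def)
    have \<rho>q: "walk_action \<S> w \<rho> q = (x_KK, y_KK)"
      unfolding \<rho>_def by (rule act.orbit_sym_aux[OF g\<rho>(1) xy_in_orbit g(2)])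
    define p' where "p' = walk_action \<S> w \<rho> p"
    have gp': "walk_action \<S> w g p' = p"
      using act.orbit_sym_aux[OF g\<rho>(2) p p'_def[symmetric]] g\<rho>(1) by (simp add: \<rho>_def)
    have "p \<in> k_orbit \<S> w \<times> k_orbit \<S> w" "q \<in> k_orbit \<S> w \<times> k_orbit \<S> w"
      using p step(2) orbit_subset by blast+
    then have "adjacent \<S> w (map_prod \<rho> \<rho> p) (map_prod \<rho> \<rho> q)"
      using walk_group_mem[OF g\<rho>(2)] step(1)
      by (intro adjacent_hom[OF Aut_k_subfield_hom const_in_k_orbit Aut_k_const])
    then have "adjacent \<S> w p' (x_KK, y_KK)"
      using \<rho>q by (simp add: p'_def walk_action_apply p step(2))
    then have "\<exists>i\<in>I\<^sub>x \<union> I\<^sub>y. map_prod i i (x_KK, y_KK) = p'"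
      unfolding adjacent_def using ex_G_x ex_G_y coset_rep_x_y[OF Ix] coset_rep_x_y[OF Iy]
      by (metis UnI1 UnI2)
    then obtain i where i: "i \<in> I\<^sub>x \<union> I\<^sub>y" "walk_action \<S> w i (x_KK, y_KK) = p'"
      using walk_action_apply[OF xy_in_orbit] by metis
    then have "i \<in> H" "i \<in> carrier (walk_group \<S> w)"
      using I by (auto simp: H_def intro: generate.incl)
    moreover have "walk_action \<S> w (g \<otimes>\<^bsub>walk_group \<S> w\<^esub> i) (x_KK, y_KK) = p"
      using act.composition_rule[OF xy_in_orbit g\<rho>(1)] \<open>i \<in> carrier (walk_group \<S> w)\<close> i(2) gp' by simp
    ultimately show ?case
      using g(1) H.m_closed by blast
  qed
  show "transitive_action (walk_group \<S> w\<lparr>carrier := H\<rparr>) (walk_orbit \<S> w) (walk_action \<S> w)"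
  proof (intro transitive_action.intro transitive_action_axioms.intro)
    have "walk_action \<S> w \<in> hom (walk_group \<S> w) (BijGroup (walk_orbit \<S> w))"
      using act.group_hom by (simp add: group_hom_def group_hom_axioms_def)
    then have "walk_action \<S> w \<in> hom (walk_group \<S> w\<lparr>carrier := H\<rparr>) (BijGroup (walk_orbit \<S> w))"
      using H.subset by (auto simp: hom_def)
    then show "group_action (walk_group \<S> w\<lparr>carrier := H\<rparr>) (walk_orbit \<S> w) (walk_action \<S> w)"
      unfolding group_action_def group_hom_def group_hom_axioms_def
      using H.subgroup_is_group[OF group_walk_group] group_BijGroup by blast
  next
    fix p q assume p: "p \<in> walk_orbit \<S> w" and q: "q \<in> walk_orbit \<S> w"
    obtain g h where g: "g \<in> H" "walk_action \<S> w g (x_KK, y_KK) = p"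
      and h: "h \<in> H" "walk_action \<S> w h (x_KK, y_KK) = q"
      using xy[OF p] xy[OF q] by blast
    \<comment> \<open>Any two points are joined through (x, y), by h after the inverse of g.\<close>
    have "walk_action \<S> w (inv\<^bsub>walk_group \<S> w\<^esub> g) p = (x_KK, y_KK)"
      using g H.subset by (intro act.orbit_sym_aux[OF _ xy_in_orbit]) auto
    then have "walk_action \<S> w (h \<otimes>\<^bsub>walk_group \<S> w\<^esub> inv\<^bsub>walk_group \<S> w\<^esub> g) p = q"
      using act.composition_rule[OF p, of h "inv\<^bsub>walk_group \<S> w\<^esub> g"] g(1) h H.subset by auto
    then show "\<exists>g\<in>carrier (walk_group \<S> w\<lparr>carrier := H\<rparr>). walk_action \<S> w g p = q"
      using H.m_closed[OF h(1) H.m_inv_closed[OF g(1)]] by auto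
  qed
qed

end

theorem theorem13:
  fixes \<S> :: "(int \<times> int) set" and w :: "int \<times> int \<Rightarrow> complex"
    and I_x I_y :: "(walk_field \<Rightarrow> walk_field) set"
  assumes "finite \<S>"
    and "\<And>s. s \<in> \<S> \<Longrightarrow> w s \<noteq> 0"
    and "not_univariate \<S>"
    and "left_coset_reps (G_x \<S> w) (G_xy \<S> w) I_x" and "\<one>\<^bsub>G_x \<S> w\<^esub> \<in> I_x"
    and "left_coset_reps (G_y \<S> w) (G_xy \<S> w) I_y" and "\<one>\<^bsub>G_y \<S> w\<^esub> \<in> I_y"
  shows "subgroup (generate (walk_group \<S> w) (I_x \<union> I_y)) (walk_group \<S> w) \<and>
         transitive_action
           ((walk_group \<S> w)\<lparr>carrier := generate (walk_group \<S> w) (I_x \<union> I_y)\<rparr>)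
           (walk_orbit \<S> w) (walk_action \<S> w)"
  using transitive_walk_action[OF assms(1) _ assms(3,4,6)] assms(2) by blast

end
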